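(* Let $\theta\in T_\rho$ and let $f:\mathbb{R}\to\mathbb{R}$ be a Lipschitz function with Lipschitz constant at most $1$. For $g\in\mathbb{R}^N$ put $F(g):=N^{-1}\sum_{i\le N}f(g_i)$. Then $$\Big|\langle F(g)\rangle-\int_{[0,\tilde\gamma]}\int_{\mathbb{R}}f(x)\,d\mu_\gamma(x)\,d\rho(\gamma)\Big|\xrightarrow[N\to\infty]{}0.$$
   Context: Eigenvalues. Fix $\tilde\gamma>0$. For each $N\ge1$ let $\gamma_1=\gamma^{(N)}_1,\dots,\gamma_N=\gamma_N^{(N)}$ be deterministic real numbers in $[0,\tilde\gamma]$ such that the empirical measures $N^{-1}\sum_{i\le N}\delta_{\gamma_i^{(N)}}$ converge, as $N\to\infty$, in the 1-Wasserstein metric to a probability measure $\rho$ on $[0,\tilde\gamma]$. Model. For $g\in\mathbb{R}^N\setminus\{0\}$ let $H_N(g):=N\sum_{i\le N}\gamma_i\, g_i^2/\|g\|^2$. Let $G$ be the standard normal measure on $\mathbb{R}^N$. For $\theta\in\mathbb{R}$ the Gibbs mean is $\langle f(g)\rangle:=\frac{1}{Z_N}\int_{\mathbb{R}^N}f(g)\,e^{\theta H_N(g)}\,dG(g)$ with $Z_N:=\int e^{\theta H_N}dG$. Transforms. For $z\in\mathbb{R}\setminus[0,\tilde\gamma]$ let $S_\rho(z):=\int\frac{\rho(d\gamma)}{z-\gamma}$, $S_{\max}:=\lim_{z\downarrow\tilde\gamma}S_\rho(z)\in(0,+\infty]$, $S_{\min}:=\lim_{z\uparrow0}S_\rho(z)\in[-\infty,0)$.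 $S_\rho$ is a bijection from $\mathbb{R}\setminus[0,\tilde\gamma]$ onto $(S_{\min},S_{\max})\setminus\{0\}$ with inverse $K_\rho$; the R-transform is $R_\rho(x):=K_\rho(x)-1/x$ on $(S_{\min},S_{\max})\setminus\{0\}$. Put $T_\rho:=(S_{\min}/2,S_{\max}/2)\setminus\{0\}$ and, for $\theta\in T_\rho$, $v(\theta):=R_\rho(2\theta)$. Limiting marginals. For $\gamma\in[0,\tilde\gamma]$, $\mu_\gamma$ is the law of a centred normal random variable with variance $\sigma_\gamma^2:=1/(1+2\theta(v(\theta)-\gamma))$ (which is positive for $\theta\in T_\rho$). *)

theory Defs
  imports "HOL-Probability.Probability"
begin

definition couplings :: "real measure \<Rightarrow> real measure \<Rightarrow> (real \<times> real) measure set" where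
  "couplings \<mu> \<nu> = {\<pi>. sets \<pi> = sets (borel \<Otimes>\<^sub>M borel) \<and>
     distr \<pi> borel fst = \<mu> \<and> distr \<pi> borel snd = \<nu>}"

text \<open>The value is an extended nonnegative real, so that convergence to 0 cannot hold
  because of a default value when the cost is infinite or there is no coupling.\<close>

definition wasserstein1 :: "real measure \<Rightarrow> real measure \<Rightarrow> ennreal" where
  "wasserstein1 \<mu> \<nu> = (INF \<pi>\<in>couplings \<mu> \<nu>. \<integral>\<^sup>+ p. ennreal \<bar>fst p - snd p\<bar> \<partial>\<pi>)"

text \<open>The uniform average of the Dirac masses at \<open>a 1, \<dots>, a N\<close>, counted with multiplicity
  (meaningful for \<open>N \<ge> 1\<close>).\<close>

definition empirical_measure :: "nat \<Rightarrow> (nat \<Rightarrow> real) \<Rightarrow> real measure" where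
  "empirical_measure N a = distr (uniform_count_measure {1..N}) borel a"

text \<open>Vectors of \<open>\<real>\<^sup>N\<close> are functions on the index set \<open>{1..N}\<close>, as in the finite product
  measure \<^const>\<open>PiM\<close>. At the null vector the Hamiltonian is 0 by the convention \<open>x / 0 = 0\<close>;
  for \<open>N \<ge> 1\<close> this is a Gaussian null set.\<close>

definition hamiltonian :: "nat \<Rightarrow> (nat \<Rightarrow> real) \<Rightarrow> (nat \<Rightarrow> real) \<Rightarrow> real" where
  "hamiltonian N a g = real N * (\<Sum>i\<in>{1..N}. a i * (g i)\<^sup>2 / (\<Sum>j\<in>{1..N}. (g j)\<^sup>2))"

definition std_gaussian :: "nat \<Rightarrow> (nat \<Rightarrow> real) measure" where
  "std_gaussian N = PiM {1..N} (\<lambda>_. density lborel std_normal_density)"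

definition partition_function :: "nat \<Rightarrow> (nat \<Rightarrow> real) \<Rightarrow> real \<Rightarrow> real" where
  "partition_function N a \<theta> = (\<integral>g. exp (\<theta> * hamiltonian N a g) \<partial>std_gaussian N)"

definition gibbs_mean ::
  "nat \<Rightarrow> (nat \<Rightarrow> real) \<Rightarrow> real \<Rightarrow> ((nat \<Rightarrow> real) \<Rightarrow> real) \<Rightarrow> real" where
  "gibbs_mean N a \<theta> F =
     1 / partition_function N a \<theta> *
     (\<integral>g. F g * exp (\<theta> * hamiltonian N a g) \<partial>std_gaussian N)"

text \<open>The parameter \<open>c\<close> is the right end point of the interval \<open>[0, c]\<close> carrying \<open>\<rho>\<close>.\<close>

definition stieltjes :: "real measure \<Rightarrow> real \<Rightarrow> real" where
  "stieltjes \<rho> z = (\<integral>x. 1 / (z - x) \<partial>\<rho>)"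

definition S_max :: "real \<Rightarrow> real measure \<Rightarrow> ereal" where
  "S_max c \<rho> = Lim (at_right c) (\<lambda>z. ereal (stieltjes \<rho> z))"

definition S_min :: "real measure \<Rightarrow> ereal" where
  "S_min \<rho> = Lim (at_left 0) (\<lambda>z. ereal (stieltjes \<rho> z))"

definition K_transform :: "real \<Rightarrow> real measure \<Rightarrow> real \<Rightarrow> real" where
  "K_transform c \<rho> = the_inv_into (- {0..c}) (stieltjes \<rho>)"

definition R_transform :: "real \<Rightarrow> real measure \<Rightarrow> real \<Rightarrow> real" where
  "R_transform c \<rho> x = K_transform c \<rho> x - 1 / x"

definition T_set :: "real \<Rightarrow> real measure \<Rightarrow> real set" where
  "T_set c \<rho> = {\<theta>. S_min \<rho> / 2 < ereal \<theta> \<and> ereal \<theta> < S_max c \<rho> / 2} - {0}"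

definition v_param :: "real \<Rightarrow> real measure \<Rightarrow> real \<Rightarrow> real" where
  "v_param c \<rho> \<theta> = R_transform c \<rho> (2 * \<theta>)"

definition limit_variance :: "real \<Rightarrow> real measure \<Rightarrow> real \<Rightarrow> real \<Rightarrow> real" where
  "limit_variance c \<rho> \<theta> \<gamma> = 1 / (1 + 2 * \<theta> * (v_param c \<rho> \<theta> - \<gamma>))"

text \<open>\<^const>\<open>normal_density\<close> takes the standard deviation, not the variance.\<close>

definition limit_marginal :: "real \<Rightarrow> real measure \<Rightarrow> real \<Rightarrow> real \<Rightarrow> real measure" where
  "limit_marginal c \<rho> \<theta> \<gamma> =
     density lborel (normal_density 0 (sqrt (limit_variance c \<rho> \<theta> \<gamma>)))"

end

theory Submission
  imports Defs
begin

text \<open>Let \<open>K = K\<^sub>\<rho>(2\<theta>)\<close>, so that \<open>\<sigma>\<^sub>\<gamma>\<^sup>2 = 1 / (2\<theta>(K - \<gamma>))\<close> and \<open>\<integral>\<sigma>\<^sub>\<gamma>\<^sup>2 d\<rho> = S\<^sub>\<rho>(K) / (2\<theta>) = 1\<close>. Let \<open>Q\<close> be the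
  product of the centred normal laws with variances \<open>\<sigma>\<^sub>\<gamma>\<^sup>2\<close>, \<open>\<gamma> = \<gamma>\<^sub>1, \<dots>, \<gamma>\<^sub>N\<close>. On the shell
  \<open>\<bar>\<parallel>g\<parallel>\<^sup>2 - N\<bar> < \<delta>N\<close> the Gibbs weight agrees with \<open>dQ/dG\<close> up to a constant and a factor
  \<open>exp(O(\<delta>)N)\<close>, because there \<open>N \<Sum>\<gamma>\<^sub>i g\<^sub>i\<^sup>2 / \<parallel>g\<parallel>\<^sup>2\<close> is \<open>\<Sum>\<gamma>\<^sub>i g\<^sub>i\<^sup>2 + O(\<delta>)N\<close>. Both measures charge the shell: for
  \<open>Q\<close> since the mean variance tends to 1, for the Gibbs measure since \<open>H\<^sub>N\<close> is homogeneous of degree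
  0, so that \<open>\<parallel>g\<parallel>\<^sup>2\<close> is still chi-squared. Under \<open>Q\<close> the average \<open>F\<close> deviates from its mean by more than
  \<open>\<eta>\<close> with probability at most \<open>2 exp(-\<kappa>(\<eta>)N)\<close>, and choosing \<open>\<delta>\<close> small against \<open>\<kappa>(\<eta>)\<close> transfers this
  to the Gibbs measure. The mean of \<open>F\<close> under \<open>Q\<close> is the integral of a Lipschitz function of \<open>\<gamma>\<close>
  against the empirical measure, hence converges by the Wasserstein assumption.\<close>

subsection \<open>Exponential moments of normal variables\<close>

abbreviation std_normal :: "real measure" where
  "std_normal \<equiv> density lborel std_normal_density"

text \<open>The density of the normal law with standard deviation \<open>s\<close> with respect to the standard one.\<close>

definition normal_ratio :: "real \<Rightarrow> real \<Rightarrow> real" where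
  "normal_ratio s x = exp ((1 - 1 / s\<^sup>2) * x\<^sup>2 / 2) / s"

lemma normal_ratio_measurable [measurable]: "normal_ratio s \<in> borel_measurable borel"
  unfolding normal_ratio_def by measurable

lemma normal_ratio_pos: "s > 0 \<Longrightarrow> normal_ratio s x > 0"
  by (simp add: normal_ratio_def)

section \<open>Changes of scale for normal laws\<close>

lemma std_normal_density_times_ratio:
  assumes "s > 0"
  shows "std_normal_density x * normal_ratio s x = normal_density 0 s x"
proof -
  have "sqrt (2 * pi * s\<^sup>2) = sqrt (2 * pi) * s"
    using assms by (simp add: real_sqrt_mult)
  moreover have "exp (- x\<^sup>2 / 2) * exp ((1 - 1 / s\<^sup>2) * x\<^sup>2 / 2) = exp (- x\<^sup>2 / (2 * s\<^sup>2))"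
    using assms by (simp add: exp_add [symmetric] field_simps)
  ultimately show ?thesis
    using assms unfolding std_normal_density_def normal_density_def normal_ratio_def
    by (simp add: field_simps)
qed

lemma normal_density_scale:
  assumes "s > 0"
  shows "s * normal_density 0 s (s * x) = std_normal_density x"
  using assms unfolding std_normal_density_def normal_density_def
  by (simp add: real_sqrt_mult power_mult_distrib)

text \<open>Both sides integrate \<open>u\<close> against the centred normal law with standard
  deviation \<open>s\<close>: on the left as the image of the standard law under scaling, on the
  right through its density. Values in \<open>ennreal\<close> allow its use on functions not yet
  known to be integrable.\<close>

lemma nn_integral_std_normal_scale:
  fixes u :: "real \<Rightarrow> ennreal"
  assumes [measurable]: "u \<in> borel_measurable borel" and s: "s > 0"
  shows "(\<integral>\<^sup>+x. u (s * x) \<partial>std_normal) = (\<integral>\<^sup>+x. ennreal (normal_ratio s x) * u x \<partial>std_normal)"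
proof -
  have "(\<integral>\<^sup>+x. ennreal (normal_ratio s x) * u x \<partial>std_normal)
      = (\<integral>\<^sup>+x. ennreal (normal_density 0 s x) * u x \<partial>lborel)"
    using s by (simp add: nn_integral_density ennreal_mult' [symmetric] mult.assoc [symmetric]
        normal_ratio_pos less_imp_le std_normal_density_times_ratio)
  also have "\<dots> = ennreal \<bar>s\<bar> * (\<integral>\<^sup>+x. ennreal (normal_density 0 s (0 + s * x)) * u (0 + s * x) \<partial>lborel)"
    using s by (subst nn_integral_real_affine [where c = s and t = 0]) auto
  also have "\<dots> = (\<integral>\<^sup>+x. ennreal (s * normal_density 0 s (s * x)) * u (s * x) \<partial>lborel)"
    using s by (subst nn_integral_cmult [symmetric]) (auto simp: ennreal_mult' mult.assoc)
  also have "\<dots> = (\<integral>\<^sup>+x. u (s * x) \<partial>std_normal)"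
    using s by (simp add: nn_integral_density normal_density_scale)
  finally show ?thesis ..
qed

lemma prob_space_std_normal: "prob_space std_normal"
  by (rule prob_space_normal_density) simp

lemma distr_std_normal_scale:
  assumes s: "s > 0"
  shows "distr std_normal borel (\<lambda>x. s * x) = density lborel (normal_density 0 s)"
proof (rule measure_eqI)
  fix A assume "A \<in> sets (distr std_normal borel (\<lambda>x. s * x))"
  then have [measurable]: "A \<in> sets borel" by simp
  have "emeasure (distr std_normal borel (\<lambda>x. s * x)) A
      = (\<integral>\<^sup>+x. indicator A x \<partial>distr std_normal borel (\<lambda>x. s * x))"
    by simp
  also have "\<dots> = (\<integral>\<^sup>+x. indicator A (s * x) \<partial>std_normal)"
    by (subst nn_integral_distr) auto
  also have "\<dots> = (\<integral>\<^sup>+x. ennreal (normal_ratio s x) * indicator A x \<partial>std_normal)"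
    using s by (intro nn_integral_std_normal_scale) auto
  also have "\<dots> = (\<integral>\<^sup>+x. ennreal (normal_density 0 s x) * indicator A x \<partial>lborel)"
    using s by (simp add: nn_integral_density ennreal_mult' [symmetric] mult.assoc [symmetric]
        normal_ratio_pos less_imp_le std_normal_density_times_ratio)
  also have "\<dots> = emeasure (density lborel (normal_density 0 s)) A"
    by (subst emeasure_density) auto
  finally show "emeasure (distr std_normal borel (\<lambda>x. s * x)) A
      = emeasure (density lborel (normal_density 0 s)) A" .
qed simp

lemma product_sigma_finite_std_normal: "product_sigma_finite (\<lambda>_. std_normal)"
  by (auto simp: product_sigma_finite_def prob_space_std_normal prob_space_imp_sigma_finite)

text \<open>The two measures behind the sides agree on boxes, where everything factorises into the
  one-dimensional case. Equal \<open>s i\<close> will control the norm under the Gibbs measure;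
  unequal ones give the density of the tilted product.\<close>

lemma nn_integral_PiM_std_normal_scale:
  fixes \<Psi> :: "('i \<Rightarrow> real) \<Rightarrow> ennreal"
  assumes I: "finite I" and s: "\<And>i. i \<in> I \<Longrightarrow> s i > 0"
    and \<Psi>: "\<Psi> \<in> borel_measurable (PiM I (\<lambda>_. std_normal))"
  shows "(\<integral>\<^sup>+g. \<Psi> (\<lambda>i\<in>I. s i * g i) \<partial>PiM I (\<lambda>_. std_normal))
    = (\<integral>\<^sup>+g. ennreal (\<Prod>i\<in>I. normal_ratio (s i) (g i)) * \<Psi> g \<partial>PiM I (\<lambda>_. std_normal))"
proof -
  let ?G = "PiM I (\<lambda>_. std_normal)"
  interpret product_sigma_finite "\<lambda>_::'i. std_normal"
    by (rule product_sigma_finite_std_normal)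
  interpret G: prob_space ?G
    by (intro prob_space_PiM prob_space_std_normal)
  have [measurable]: "(\<lambda>g. \<lambda>i\<in>I. s i * g i) \<in> measurable ?G ?G"
    by (intro measurable_restrict) measurable
  have [measurable]: "(\<lambda>g. \<Prod>i\<in>I. normal_ratio (s i) (g i)) \<in> borel_measurable ?G"
    by measurable
  have "distr ?G ?G (\<lambda>g. \<lambda>i\<in>I. s i * g i) = density ?G (\<lambda>g. ennreal (\<Prod>i\<in>I. normal_ratio (s i) (g i)))"
  proof (rule measure_eqI_PiM_finite [OF I, where A = "\<lambda>_. space ?G" and M = "\<lambda>_. std_normal"])
    fix A :: "'i \<Rightarrow> real set" assume A: "\<And>i. i \<in> I \<Longrightarrow> A i \<in> sets std_normal"
    then have A': "\<And>i. i \<in> I \<Longrightarrow> A i \<in> sets borel" by simp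
    have AS: "Pi\<^sub>E I A \<in> sets ?G"
      using A I by (intro sets_PiM_I_finite) auto
    \<comment> \<open>Extensionality matters: a function with the right values on \<open>I\<close>
      lies in \<open>Pi\<^sub>E I A\<close> only if it is \<open>undefined\<close> outside
      \<open>I\<close>.\<close>
    have ind: "indicator (Pi\<^sub>E I A) g = (\<Prod>i\<in>I. indicator (A i) (g i) :: ennreal)" if "g \<in> extensional I" for g
      using I that by (auto simp: indicator_def PiE_def Pi_def prod_zero_iff)
    have "emeasure (distr ?G ?G (\<lambda>g. \<lambda>i\<in>I. s i * g i)) (Pi\<^sub>E I A)
        = (\<integral>\<^sup>+g. indicator (Pi\<^sub>E I A) (\<lambda>i\<in>I. s i * g i) \<partial>?G)"
      using AS by (subst nn_integral_indicator [symmetric], simp, subst nn_integral_distr) auto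
    also have "\<dots> = (\<integral>\<^sup>+g. (\<Prod>i\<in>I. indicator (A i) (s i * g i)) \<partial>?G)"
      by (intro nn_integral_cong, subst ind) (auto intro!: prod.cong)
    also have "\<dots> = (\<Prod>i\<in>I. \<integral>\<^sup>+x. indicator (A i) (s i * x) \<partial>std_normal)"
      using I A' by (intro product_nn_integral_prod) auto
    also have "\<dots> = (\<Prod>i\<in>I. \<integral>\<^sup>+x. ennreal (normal_ratio (s i) x) * indicator (A i) x \<partial>std_normal)"
      using s A' by (intro prod.cong refl nn_integral_std_normal_scale) auto
    also have "\<dots> = (\<integral>\<^sup>+g. (\<Prod>i\<in>I. ennreal (normal_ratio (s i) (g i)) * indicator (A i) (g i)) \<partial>?G)"
      using I A' by (intro product_nn_integral_prod [symmetric]) auto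
    also have "\<dots> = (\<integral>\<^sup>+g. ennreal (\<Prod>i\<in>I. normal_ratio (s i) (g i)) * indicator (Pi\<^sub>E I A) g \<partial>?G)"
    proof (intro nn_integral_cong)
      fix g assume "g \<in> space ?G"
      then have "g \<in> extensional I" by (simp add: space_PiM PiE_def)
      then show "(\<Prod>i\<in>I. ennreal (normal_ratio (s i) (g i)) * indicator (A i) (g i))
          = ennreal (\<Prod>i\<in>I. normal_ratio (s i) (g i)) * indicator (Pi\<^sub>E I A) g"
        using s by (simp add: ind prod.distrib prod_ennreal normal_ratio_pos less_imp_le)
    qed
    also have "\<dots> = emeasure (density ?G (\<lambda>g. ennreal (\<Prod>i\<in>I. normal_ratio (s i) (g i)))) (Pi\<^sub>E I A)"
      using AS by (subst emeasure_density) auto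
    finally show "emeasure (distr ?G ?G (\<lambda>g. \<lambda>i\<in>I. s i * g i)) (Pi\<^sub>E I A)
        = emeasure (density ?G (\<lambda>g. ennreal (\<Prod>i\<in>I. normal_ratio (s i) (g i)))) (Pi\<^sub>E I A)" .
  next
    \<comment> \<open>The measure is finite, so the constant sequence \<open>space ?G\<close> serves
      as the exhausting sequence.\<close>
    show "range (\<lambda>_::nat. space ?G) \<subseteq> prod_algebra I (\<lambda>_. std_normal)"
      using I by (auto simp: space_PiM intro!: prod_algebraI_finite)
    show "emeasure (distr ?G ?G (\<lambda>g. \<lambda>i\<in>I. s i * g i)) (space ?G) \<noteq> \<infinity>" for i :: nat
      by (subst emeasure_distr) (auto simp: G.emeasure_eq_measure)
  qed auto
  then have "(\<integral>\<^sup>+g. \<Psi> g \<partial>distr ?G ?G (\<lambda>g. \<lambda>i\<in>I. s i * g i))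
      = (\<integral>\<^sup>+g. \<Psi> g \<partial>density ?G (\<lambda>g. ennreal (\<Prod>i\<in>I. normal_ratio (s i) (g i))))"
    by simp
  then show ?thesis
    using \<Psi> by (subst (asm) nn_integral_distr; (subst (asm) nn_integral_density)?) auto
qed

section \<open>Moment generating functions and Chernoff bounds\<close>

lemma nn_integral_std_normal_exp_square:
  assumes "t < 1/2"
  shows "(\<integral>\<^sup>+x. ennreal (exp (t * x\<^sup>2)) \<partial>std_normal) = ennreal (1 / sqrt (1 - 2 * t))"
proof -
  interpret prob_space std_normal by (rule prob_space_std_normal)
  \<comment> \<open>With this \<open>s\<close>, \<open>normal_ratio s x\<close> is exp(t x^2) / s,
    and its integral is 1 by the scaling lemma for the constant function 1.\<close>
  define s where "s = 1 / sqrt (1 - 2 * t)"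
  have s: "s > 0" "1 - 1 / s\<^sup>2 = 2 * t"
    using assms by (auto simp: s_def field_simps)
  have "1 = (\<integral>\<^sup>+x. ennreal (normal_ratio s x) \<partial>std_normal)"
    using nn_integral_std_normal_scale [of "\<lambda>_. 1" s] s emeasure_space_1 by simp
  also have "\<dots> = (\<integral>\<^sup>+x. ennreal (1 / s) * ennreal (exp (t * x\<^sup>2)) \<partial>std_normal)"
    using s by (intro nn_integral_cong) (simp add: normal_ratio_def ennreal_mult' [symmetric])
  also have "\<dots> = ennreal (1 / s) * (\<integral>\<^sup>+x. ennreal (exp (t * x\<^sup>2)) \<partial>std_normal)"
    by (subst nn_integral_cmult) auto
  finally have "ennreal s * 1 = ennreal s * (ennreal (1 / s) * (\<integral>\<^sup>+x. ennreal (exp (t * x\<^sup>2)) \<partial>std_normal))"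
    by simp
  then show ?thesis
    using s by (simp add: mult.assoc [symmetric] ennreal_mult' [symmetric]) (simp add: s_def)
qed

text \<open>In the logarithm of the Laplace transform of x^2 - 1 the terms linear in t cancel. Since
  |2t| \<le> 1/2, the bound |ln(1 + y) - y| \<le> 2 y^2 applies at y = -2t and, after halving,
  leaves 4 t^2.\<close>

lemma chi_square_exponent_bound:
  fixes t :: real
  assumes "\<bar>t\<bar> \<le> 1/4"
  shows "exp (- t) * (1 / sqrt (1 - 2 * t)) \<le> exp (4 * t\<^sup>2)"
proof -
  have "\<bar>ln (1 + (- 2 * t)) - (- 2 * t)\<bar> \<le> 2 * (- 2 * t)\<^sup>2"
    using assms by (intro abs_ln_one_plus_x_minus_x_bound) auto
  then have *: "- t - ln (1 - 2 * t) / 2 \<le> 4 * t\<^sup>2"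
    by (simp add: power2_eq_square)
  have pos: "1 - 2 * t > 0" using assms by auto
  have "1 / sqrt (1 - 2 * t) = exp (- ln (1 - 2 * t) / 2)"
    using pos by (simp add: exp_minus ln_sqrt [symmetric] field_simps)
  then have "exp (- t) * (1 / sqrt (1 - 2 * t)) = exp (- t - ln (1 - 2 * t) / 2)"
    by (simp add: exp_add [symmetric])
  with * show ?thesis by simp
qed

lemma nn_integral_std_normal_centred_square:
  assumes "\<bar>t\<bar> \<le> 1/4"
  shows "(\<integral>\<^sup>+x. ennreal (exp (t * (x\<^sup>2 - 1))) \<partial>std_normal) \<le> ennreal (exp (4 * t\<^sup>2))"
proof -
  have "(\<integral>\<^sup>+x. ennreal (exp (t * (x\<^sup>2 - 1))) \<partial>std_normal)
      = (\<integral>\<^sup>+x. ennreal (exp (- t)) * ennreal (exp (t * x\<^sup>2)) \<partial>std_normal)"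
    by (intro nn_integral_cong) (simp add: ennreal_mult' [symmetric] exp_add [symmetric] algebra_simps)
  also have "\<dots> = ennreal (exp (- t)) * (\<integral>\<^sup>+x. ennreal (exp (t * x\<^sup>2)) \<partial>std_normal)"
    by (subst nn_integral_cmult) auto
  also have "\<dots> = ennreal (exp (- t) * (1 / sqrt (1 - 2 * t)))"
    using assms by (subst nn_integral_std_normal_exp_square) (auto simp: ennreal_mult' [symmetric])
  finally show ?thesis
    using chi_square_exponent_bound [OF assms] by (simp add: ennreal_leI)
qed

lemma nn_integral_std_normal_exp_abs:
  "(\<integral>\<^sup>+x. ennreal (exp (s * \<bar>x\<bar>)) \<partial>std_normal) \<le> ennreal (exp (s\<^sup>2) * sqrt 2)"
proof -
  \<comment> \<open>The weight 1/4 on x^2 stays below the critical value 1/2; the exponential moment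
    of x^2 / 4 is \<open>sqrt 2\<close>.\<close>
  have "s * \<bar>x\<bar> \<le> s\<^sup>2 + 1/4 * x\<^sup>2" for x :: real
    using zero_le_power2 [of "s - \<bar>x\<bar> / 2"] by (simp add: power2_diff power_divide)
  then have "(\<integral>\<^sup>+x. ennreal (exp (s * \<bar>x\<bar>)) \<partial>std_normal)
      \<le> (\<integral>\<^sup>+x. ennreal (exp (s\<^sup>2)) * ennreal (exp (1/4 * x\<^sup>2)) \<partial>std_normal)"
    by (intro nn_integral_mono) (simp add: ennreal_mult' [symmetric] exp_add [symmetric])
  also have "\<dots> = ennreal (exp (s\<^sup>2)) * (\<integral>\<^sup>+x. ennreal (exp (1/4 * x\<^sup>2)) \<partial>std_normal)"
    by (subst nn_integral_cmult) auto
  also have "\<dots> = ennreal (exp (s\<^sup>2) * sqrt 2)"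
    by (subst nn_integral_std_normal_exp_square)
      (auto simp: ennreal_mult' [symmetric] real_sqrt_divide field_simps)
  finally show ?thesis .
qed

text \<open>A second order Taylor expansion whose remainder can be integrated. Since |t| \<le> 1/2,
  the Lagrange factor costs only exp(|y|/2), and the other half of exp |y| absorbs y^2.\<close>

lemma exp_le_quadratic:
  fixes t y :: real
  assumes "\<bar>t\<bar> \<le> 1/2"
  shows "exp (t * y) \<le> 1 + t * y + 4 * t\<^sup>2 * exp \<bar>y\<bar>"
proof -
  obtain r where r: "\<bar>r\<bar> \<le> \<bar>t * y\<bar>"
      "exp (t * y) = (\<Sum>m<2. (t * y) ^ m / fact m) + exp r / fact 2 * (t * y) ^ 2"
    using Maclaurin_exp_le [of "t * y" 2] by auto
  have "\<bar>t * y\<bar> \<le> 1/2 * \<bar>y\<bar>"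
    unfolding abs_mult using assms by (intro mult_right_mono) auto
  then have er: "exp r \<le> exp (\<bar>y\<bar> / 2)" using r(1) by simp
  have "1 + \<bar>y\<bar>/2 + (\<bar>y\<bar>/2)\<^sup>2 / 2 \<le> exp (\<bar>y\<bar>/2)"
    by (rule exp_lower_Taylor_quadratic) simp
  then have ey: "y\<^sup>2 / 2 \<le> 4 * exp (\<bar>y\<bar>/2)" by (simp add: power_divide)
  have "exp r * (y\<^sup>2 / 2) \<le> exp (\<bar>y\<bar> / 2) * (4 * exp (\<bar>y\<bar>/2))"
    using er ey by (intro mult_mono) auto
  also have "\<dots> = 4 * exp \<bar>y\<bar>" by (simp add: exp_add [symmetric])
  finally have "t\<^sup>2 * (exp r * (y\<^sup>2 / 2)) \<le> t\<^sup>2 * (4 * exp \<bar>y\<bar>)"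
    by (intro mult_left_mono) auto
  then show ?thesis
    using r(2) by (simp add: numeral_2_eq_2 power_mult_distrib) (simp add: field_simps)
qed

text \<open>Integrating \<open>exp_le_quadratic\<close> removes the linear term because
  \<open>Y\<close> is centred. Then 1 + x \<le> exp x gives an exponential, the form that multiplies
  well over independent coordinates.\<close>

lemma (in prob_space) nn_integral_exp_centred_le:
  assumes Y: "integrable M Y" "expectation Y = 0"
    and C: "(\<integral>\<^sup>+x. ennreal (exp \<bar>Y x\<bar>) \<partial>M) \<le> ennreal C" "C \<ge> 0" and t: "\<bar>t\<bar> \<le> 1/2"
  shows "(\<integral>\<^sup>+x. ennreal (exp (t * Y x)) \<partial>M) \<le> ennreal (exp (4 * C * t\<^sup>2))"
proof -
  have [measurable]: "Y \<in> borel_measurable M" using Y by simp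
  have int: "integrable M (\<lambda>x. exp \<bar>Y x\<bar>)"
    using C(1) by (intro integrableI_nonneg) (auto intro: le_less_trans)
  have "ennreal (expectation (\<lambda>x. exp \<bar>Y x\<bar>)) \<le> ennreal C"
    using C int by (subst nn_integral_eq_integral [symmetric]) auto
  then have le: "expectation (\<lambda>x. exp \<bar>Y x\<bar>) \<le> C" using C(2) by (simp add: ennreal_le_iff)
  have int2: "integrable M (\<lambda>x. 1 + t * Y x + 4 * t\<^sup>2 * exp \<bar>Y x\<bar>)"
    using int Y by auto
  have "(\<integral>\<^sup>+x. ennreal (exp (t * Y x)) \<partial>M) \<le> (\<integral>\<^sup>+x. ennreal (1 + t * Y x + 4 * t\<^sup>2 * exp \<bar>Y x\<bar>) \<partial>M)"
    by (intro nn_integral_mono ennreal_leI exp_le_quadratic t)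
  also have "\<dots> = ennreal (expectation (\<lambda>x. 1 + t * Y x + 4 * t\<^sup>2 * exp \<bar>Y x\<bar>))"
    by (intro nn_integral_eq_integral int2 AE_I2 order.trans [OF _ exp_le_quadratic [OF t]]) auto
  also have "expectation (\<lambda>x. 1 + t * Y x + 4 * t\<^sup>2 * exp \<bar>Y x\<bar>)
      = 1 + 4 * t\<^sup>2 * expectation (\<lambda>x. exp \<bar>Y x\<bar>)"
    using int Y by (simp add: prob_space)
  also have "\<dots> \<le> 1 + 4 * t\<^sup>2 * C"
    using le by (intro add_left_mono mult_left_mono) auto
  also have "\<dots> \<le> exp (4 * C * t\<^sup>2)"
    using exp_ge_add_one_self [of "4 * C * t\<^sup>2"] by (simp add: mult_ac)
  finally show ?thesis by (simp add: ennreal_leI)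
qed

lemma (in prob_space) exponential_concentration:
  assumes [measurable]: "S \<in> borel_measurable M" and pos: "C > 0" "t0 > 0" "\<eta> > 0"
    and mgf: "\<And>t. \<bar>t\<bar> \<le> t0 \<Longrightarrow> (\<integral>\<^sup>+x. ennreal (exp (t * S x)) \<partial>M) \<le> ennreal (exp (C * t\<^sup>2 * n))"
    and n: "n \<ge> 0"
  shows "prob {x \<in> space M. \<bar>S x\<bar> \<ge> \<eta> * n} \<le> 2 * exp (- (min t0 (\<eta> / (2 * C)) * \<eta> / 2 * n))"
proof -
  \<comment> \<open>The minimiser of C t^2 - \<eta> t, capped at \<open>t0\<close>. In either case C
    t \<le> \<eta>/2, so at least half of the linear gain survives.\<close>
  define t where "t = min t0 (\<eta> / (2 * C))"
  have t: "t > 0" "\<bar>t\<bar> \<le> t0" "C * t \<le> \<eta> / 2"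
    using pos by (auto simp: t_def min_def field_simps)
  have ex: "- t * (\<eta> * n) + C * t\<^sup>2 * n \<le> - (t * \<eta> / 2 * n)"
  proof -
    have "C * t * (t * n) \<le> \<eta> / 2 * (t * n)" using t n by (intro mult_right_mono) auto
    then show ?thesis by (simp add: power2_eq_square algebra_simps)
  qed
  have half: "prob {x \<in> space M. \<eta> * n \<le> \<sigma> * S x} \<le> exp (- (t * \<eta> / 2 * n))" if \<sigma>: "\<sigma> = 1 \<or> \<sigma> = -1" for \<sigma> :: real
  proof -
    have "emeasure M {x \<in> space M. \<eta> * n \<le> \<sigma> * S x} \<le> ennreal (exp (- t * (\<eta> * n)))
        * (\<integral>\<^sup>+x. ennreal (exp (t * (\<sigma> * S x))) * indicator (space M) x \<partial>M)"
      using t by (intro Chernoff_ineq_nn_integral_ge) auto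
    also have "(\<integral>\<^sup>+x. ennreal (exp (t * (\<sigma> * S x))) * indicator (space M) x \<partial>M)
        = (\<integral>\<^sup>+x. ennreal (exp ((t * \<sigma>) * S x)) \<partial>M)"
      by (intro nn_integral_cong) (simp add: mult.assoc)
    also have "\<dots> \<le> ennreal (exp (C * t\<^sup>2 * n))"
      using mgf [of "t * \<sigma>"] t \<sigma> by auto
    finally have "emeasure M {x \<in> space M. \<eta> * n \<le> \<sigma> * S x}
        \<le> ennreal (exp (- t * (\<eta> * n))) * ennreal (exp (C * t\<^sup>2 * n))"
      by (simp add: mult_left_mono)
    also have "\<dots> \<le> ennreal (exp (- (t * \<eta> / 2 * n)))"
      using ex by (simp add: ennreal_mult' [symmetric] exp_add [symmetric])
    finally show ?thesis by (simp add: emeasure_eq_measure)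
  qed
  have "{x \<in> space M. \<bar>S x\<bar> \<ge> \<eta> * n}
      \<subseteq> {x \<in> space M. \<eta> * n \<le> 1 * S x} \<union> {x \<in> space M. \<eta> * n \<le> -1 * S x}"
    by auto
  then have "prob {x \<in> space M. \<bar>S x\<bar> \<ge> \<eta> * n}
      \<le> prob ({x \<in> space M. \<eta> * n \<le> 1 * S x} \<union> {x \<in> space M. \<eta> * n \<le> -1 * S x})"
    by (intro finite_measure_mono) auto
  also have "\<dots> \<le> prob {x \<in> space M. \<eta> * n \<le> 1 * S x} + prob {x \<in> space M. \<eta> * n \<le> -1 * S x}"
    by (intro measure_Un_le) auto
  also have "\<dots> \<le> 2 * exp (- (t * \<eta> / 2 * n))"
    using half [of 1] half [of "-1"] by simp
  finally show ?thesis by (simp add: t_def)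
qed

subsection \<open>The Gibbs measure and the tilted product measure\<close>

declare One_nat_def [simp del]

lemma std_gaussian_eq: "std_gaussian N = PiM {1..N} (\<lambda>_. std_normal)"
  by (simp add: std_gaussian_def)

lemma prob_space_std_gaussian: "prob_space (std_gaussian N)"
  unfolding std_gaussian_eq by (intro prob_space_PiM prob_space_std_normal)

lemma measurable_std_gaussian_component [measurable (raw)]:
  assumes "i \<in> {1..N}"
  shows "(\<lambda>g. g i) \<in> borel_measurable (std_gaussian N)"
  unfolding std_gaussian_eq using assms by (simp add: measurable_component_singleton)

lemma std_gaussian_scale_measurable [measurable]:
  "(\<lambda>g. \<lambda>i\<in>{1..N}. s i * g i) \<in> measurable (std_gaussian N) (std_gaussian N)"
  unfolding std_gaussian_eq by (intro measurable_restrict) measurable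

lemma hamiltonian_measurable [measurable]: "hamiltonian N a \<in> borel_measurable (std_gaussian N)"
proof -
  have *: "hamiltonian N a = (\<lambda>g. real N * ((\<Sum>i\<in>{1..N}. a i * (g i)\<^sup>2) / (\<Sum>j\<in>{1..N}. (g j)\<^sup>2)))"
    by (simp add: hamiltonian_def fun_eq_iff sum_divide_distrib)
  show ?thesis unfolding * by measurable
qed

text \<open>Without the division the identity also holds at the null vector, where both sides
  vanish, so the comparison of densities needs no exceptional set.\<close>

lemma hamiltonian_times_norm:
  "hamiltonian N a g * (\<Sum>i\<in>{1..N}. (g i)\<^sup>2) = real N * (\<Sum>i\<in>{1..N}. a i * (g i)\<^sup>2)"
proof (cases "(\<Sum>i\<in>{1..N}. (g i)\<^sup>2) = 0")
  case True
  then have "\<forall>i\<in>{1..N}. g i = 0" by (subst (asm) sum_nonneg_eq_0_iff) auto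
  then show ?thesis by simp
next
  case False
  then show ?thesis by (simp add: hamiltonian_def sum_divide_distrib [symmetric])
qed

lemma hamiltonian_bounds:
  assumes "\<And>i. i \<in> {1..N} \<Longrightarrow> a i \<in> {0..c}" "c \<ge> 0"
  shows "0 \<le> hamiltonian N a g" "hamiltonian N a g \<le> c * real N"
proof -
  let ?r = "\<Sum>j\<in>{1..N}. (g j)\<^sup>2"
  have r: "?r \<ge> 0" by (intro sum_nonneg) auto
  show "0 \<le> hamiltonian N a g"
    unfolding hamiltonian_def using assms r by (intro mult_nonneg_nonneg sum_nonneg divide_nonneg_nonneg) auto
  have "(\<Sum>i\<in>{1..N}. a i * (g i)\<^sup>2 / ?r) \<le> (\<Sum>i\<in>{1..N}. c * (g i)\<^sup>2 / ?r)"
    using assms r by (intro sum_mono divide_right_mono mult_right_mono) auto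
  also have "\<dots> = c * ?r / ?r"
    by (simp add: sum_divide_distrib [symmetric] sum_distrib_left)
  \<comment> \<open>Only an inequality: at the null vector the quotient is 0 by the convention for
    division, and \<open>c \<ge> 0\<close> is used.\<close>
  also have "\<dots> \<le> c"
    using assms by (cases "?r = 0") auto
  finally show "hamiltonian N a g \<le> c * real N"
    unfolding hamiltonian_def by (simp add: mult.commute [of c] mult_left_mono)
qed

lemma hamiltonian_scale:
  assumes "t \<noteq> 0"
  shows "hamiltonian N a (\<lambda>i\<in>{1..N}. t * g i) = hamiltonian N a g"
proof -
  have "(\<Sum>i\<in>{1..N}. a i * (t * g i)\<^sup>2 / (\<Sum>j\<in>{1..N}. (t * g j)\<^sup>2))
      = (\<Sum>i\<in>{1..N}. a i * (g i)\<^sup>2 / (\<Sum>j\<in>{1..N}. (g j)\<^sup>2))"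
    using assms by (intro sum.cong refl) (simp add: power_mult_distrib sum_distrib_left [symmetric])
  then show ?thesis
    unfolding hamiltonian_def by simp
qed

text \<open>Independence turns the exponential moment of the sum into a product. One pair
  \<open>C\<close>, \<open>t0\<close> valid for all coordinates then gives exp(C t^2 N), and the
  Chernoff bound has a rate free of \<open>N\<close>.\<close>

lemma std_gaussian_sum_concentration:
  fixes Y :: "nat \<Rightarrow> real \<Rightarrow> real"
  assumes Y: "\<And>i. i \<in> {1..N} \<Longrightarrow> Y i \<in> borel_measurable borel"
    and pos: "C > 0" "t0 > 0" "\<eta> > 0"
    and mgf: "\<And>i t. i \<in> {1..N} \<Longrightarrow> \<bar>t\<bar> \<le> t0 \<Longrightarrow>
      (\<integral>\<^sup>+x. ennreal (exp (t * Y i x)) \<partial>std_normal) \<le> ennreal (exp (C * t\<^sup>2))"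
  shows "measure (std_gaussian N) {g \<in> space (std_gaussian N). \<bar>\<Sum>i\<in>{1..N}. Y i (g i)\<bar> \<ge> \<eta> * real N}
    \<le> 2 * exp (- (min t0 (\<eta> / (2 * C)) * \<eta> / 2 * real N))"
proof -
  interpret prob_space "std_gaussian N" by (rule prob_space_std_gaussian)
  interpret product_sigma_finite "\<lambda>_::nat. std_normal"
    by (rule product_sigma_finite_std_normal)
  show ?thesis
  proof (rule exponential_concentration [OF _ pos])
    show "(\<lambda>g. \<Sum>i\<in>{1..N}. Y i (g i)) \<in> borel_measurable (std_gaussian N)"
      using Y by measurable
    fix t assume t: "\<bar>t\<bar> \<le> t0"
    have "(\<integral>\<^sup>+g. ennreal (exp (t * (\<Sum>i\<in>{1..N}. Y i (g i)))) \<partial>std_gaussian N)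
        = (\<integral>\<^sup>+g. (\<Prod>i\<in>{1..N}. ennreal (exp (t * Y i (g i)))) \<partial>PiM {1..N} (\<lambda>_. std_normal))"
      by (simp add: std_gaussian_eq prod_ennreal sum_distrib_left exp_sum)
    also have "\<dots> = (\<Prod>i\<in>{1..N}. \<integral>\<^sup>+x. ennreal (exp (t * Y i x)) \<partial>std_normal)"
      using Y by (intro product_nn_integral_prod) auto
    also have "\<dots> \<le> (\<Prod>i\<in>{1..N}. ennreal (exp (C * t\<^sup>2)))"
      using mgf t by (intro prod_mono_ennreal) auto
    also have "\<dots> = ennreal (exp (C * t\<^sup>2 * real N))"
      by (subst prod_ennreal) (simp_all add: exp_of_nat_mult [symmetric] mult.commute)
    finally show "(\<integral>\<^sup>+g. ennreal (exp (t * (\<Sum>i\<in>{1..N}. Y i (g i)))) \<partial>std_gaussian N)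
        \<le> ennreal (exp (C * t\<^sup>2 * real N))" .
  qed simp
qed

section \<open>The Gibbs measure and the law of the norm under it\<close>

definition gibbs_measure :: "nat \<Rightarrow> (nat \<Rightarrow> real) \<Rightarrow> real \<Rightarrow> (nat \<Rightarrow> real) measure" where
  "gibbs_measure N a \<theta> = density (std_gaussian N)
     (\<lambda>g. ennreal (exp (\<theta> * hamiltonian N a g) / partition_function N a \<theta>))"

text \<open>A fixed dimension and spectrum. By homogeneity of the Hamiltonian, the constants in the
  norm bounds proved here depend neither on \<open>a\<close>, \<open>c\<close> nor on
  \<theta>.\<close>

locale bounded_spectrum =
  fixes N :: nat and a :: "nat \<Rightarrow> real" and c \<theta> :: real
  assumes N_pos: "N \<ge> 1" and c_nonneg: "c \<ge> 0"
    and a_range: "\<And>i. i \<in> {1..N} \<Longrightarrow> a i \<in> {0..c}"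
begin

abbreviation "r2 g \<equiv> \<Sum>i\<in>{1..N}. (g i :: real)\<^sup>2"
abbreviation "G \<equiv> std_gaussian N"
abbreviation "H \<equiv> hamiltonian N a"
abbreviation "Z \<equiv> partition_function N a \<theta>"
abbreviation "P \<equiv> gibbs_measure N a \<theta>"

lemma space_P [simp]: "space P = space G" and sets_P [measurable_cong, simp]: "sets P = sets G"
  by (simp_all add: gibbs_measure_def)

lemma abs_H_le: "\<bar>H g\<bar> \<le> c * real N"
  using hamiltonian_bounds [of N a c g] a_range c_nonneg by simp

lemma integrable_weight: "integrable G (\<lambda>g. exp (\<theta> * H g))"
proof -
  interpret prob_space G by (rule prob_space_std_gaussian)
  show ?thesis
  proof (rule integrable_const_bound [where B = "exp (\<bar>\<theta>\<bar> * (c * real N))"])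
    have "\<theta> * H g \<le> \<bar>\<theta>\<bar> * (c * real N)" for g
    proof -
      have "\<theta> * H g \<le> \<bar>\<theta>\<bar> * \<bar>H g\<bar>" by (metis abs_ge_self abs_mult)
      also have "\<dots> \<le> \<bar>\<theta>\<bar> * (c * real N)" by (intro mult_left_mono abs_H_le) auto
      finally show ?thesis .
    qed
    then show "AE g in G. norm (exp (\<theta> * H g)) \<le> exp (\<bar>\<theta>\<bar> * (c * real N))"
      by simp
  qed measurable
qed

lemma Z_pos: "Z > 0"
proof -
  interpret prob_space G by (rule prob_space_std_gaussian)
  have "Z \<ge> 0" unfolding partition_function_def by (intro Bochner_Integration.integral_nonneg) auto
  moreover have "Z \<noteq> 0"
    unfolding partition_function_def
    using integrable_weight by (subst integral_nonneg_eq_0_iff_AE) (auto simp: AE_const)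
  ultimately show ?thesis by linarith
qed

lemma nn_integral_weight: "(\<integral>\<^sup>+g. ennreal (exp (\<theta> * H g)) \<partial>G) = ennreal Z"
  unfolding partition_function_def by (intro nn_integral_eq_integral integrable_weight) auto

lemma nn_integral_P:
  assumes [measurable]: "u \<in> borel_measurable G"
  shows "(\<integral>\<^sup>+g. u g \<partial>P) = (\<integral>\<^sup>+g. ennreal (exp (\<theta> * H g)) * u g \<partial>G) / ennreal Z"
proof -
  have "(\<integral>\<^sup>+g. u g \<partial>P) = (\<integral>\<^sup>+g. ennreal (exp (\<theta> * H g) / Z) * u g \<partial>G)"
    unfolding gibbs_measure_def by (subst nn_integral_density) auto
  also have "\<dots> = (\<integral>\<^sup>+g. ennreal (exp (\<theta> * H g)) * u g / ennreal Z \<partial>G)"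
    using Z_pos by (intro nn_integral_cong)
      (simp add: divide_ennreal [symmetric] ennreal_times_divide mult.commute)
  also have "\<dots> = (\<integral>\<^sup>+g. ennreal (exp (\<theta> * H g)) * u g \<partial>G) / ennreal Z"
    by (subst nn_integral_divide) auto
  finally show ?thesis .
qed

lemma prob_space_P: "prob_space P"
proof
  have "emeasure P (space P) = (\<integral>\<^sup>+g. 1 \<partial>P)" by simp
  also have "\<dots> = ennreal Z / ennreal Z"
    by (subst nn_integral_P) (auto simp: nn_integral_weight)
  also have "\<dots> = 1" using Z_pos by (simp add: divide_ennreal)
  finally show "emeasure P (space P) = 1" .
qed

text \<open>The density rule for the Bochner integral covers every measurable function: if
  \<open>F\<close> is not integrable, both sides take the default value 0.\<close>

lemma gibbs_mean_eq:
  assumes [measurable]: "F \<in> borel_measurable G"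
  shows "gibbs_mean N a \<theta> F = (\<integral>g. F g \<partial>P)"
proof -
  have "(\<integral>g. F g \<partial>P) = (\<integral>g. (exp (\<theta> * H g) / Z) *\<^sub>R F g \<partial>G)"
    unfolding gibbs_measure_def using Z_pos by (intro integral_density) auto
  also have "\<dots> = (\<integral>g. (1 / Z) * (F g * exp (\<theta> * H g)) \<partial>G)"
    by (intro Bochner_Integration.integral_cong) auto
  also have "\<dots> = (1 / Z) * (\<integral>g. F g * exp (\<theta> * H g) \<partial>G)"
    by (rule integral_mult_right_zero)
  finally show ?thesis by (simp add: gibbs_mean_def)
qed

text \<open>The Hamiltonian is homogeneous of degree 0, so the change of variables \<open>g \<mapsto> t g\<close> shows that
  the squared norm has the same exponential moments under the Gibbs measure as under \<open>G\<close>.\<close>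

lemma nn_integral_P_exp_norm:
  assumes t: "\<bar>t\<bar> \<le> 1/4"
  shows "(\<integral>\<^sup>+g. ennreal (exp (t * (r2 g - real N))) \<partial>P) \<le> ennreal (exp (4 * t\<^sup>2 * real N))"
proof -
  \<comment> \<open>Scaling every coordinate by this \<open>s\<close> gives the density exp(t r2) /
    s^N. Since \<open>H\<close> does not see the scaling, \<open>Z\<close> is also the integral of
    the weight against that density, so the required moment is an explicit power independent of
    \<open>H\<close>.\<close>
  define s where "s = 1 / sqrt (1 - 2 * t)"
  have s: "s > 0" "1 - 1 / s\<^sup>2 = 2 * t"
    using t by (auto simp: s_def field_simps)
  have ratio: "(\<Prod>i\<in>{1..N}. normal_ratio s (g i)) = exp (t * r2 g) / s ^ N" for g :: "nat \<Rightarrow> real"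
    using s by (simp add: normal_ratio_def prod_dividef exp_sum [symmetric] sum_distrib_left)
  have "ennreal Z = (\<integral>\<^sup>+g. ennreal (exp (\<theta> * H (\<lambda>i\<in>{1..N}. s * g i))) \<partial>G)"
    using s by (subst hamiltonian_scale) (auto simp: nn_integral_weight)
  also have "\<dots> = (\<integral>\<^sup>+g. ennreal (\<Prod>i\<in>{1..N}. normal_ratio s (g i)) * ennreal (exp (\<theta> * H g)) \<partial>G)"
    unfolding std_gaussian_eq using s
    by (intro nn_integral_PiM_std_normal_scale) (auto simp: std_gaussian_eq [symmetric])
  finally have Z: "ennreal Z = (\<integral>\<^sup>+g. ennreal (exp (t * r2 g) / s ^ N) * ennreal (exp (\<theta> * H g)) \<partial>G)"
    by (simp add: ratio)
  have "(\<integral>\<^sup>+g. ennreal (exp (\<theta> * H g)) * ennreal (exp (t * (r2 g - real N))) \<partial>G)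
      = (\<integral>\<^sup>+g. ennreal (exp (- t) ^ N * s ^ N) * (ennreal (exp (t * r2 g) / s ^ N) * ennreal (exp (\<theta> * H g))) \<partial>G)"
    using s by (intro nn_integral_cong)
      (simp add: ennreal_mult' [symmetric] exp_of_nat_mult [symmetric] exp_add [symmetric] algebra_simps)
  also have "\<dots> = ennreal (exp (- t) ^ N * s ^ N) * ennreal Z"
    unfolding Z by (subst nn_integral_cmult) auto
  finally have "(\<integral>\<^sup>+g. ennreal (exp (t * (r2 g - real N))) \<partial>P)
      = ennreal (exp (- t) ^ N * s ^ N) * ennreal Z / ennreal Z"
    by (subst nn_integral_P) auto
  also have "\<dots> = ennreal ((exp (- t) * s) ^ N)"
    using Z_pos s by (simp add: ennreal_mult' [symmetric] divide_ennreal power_mult_distrib)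
  also have "\<dots> \<le> ennreal (exp (4 * t\<^sup>2) ^ N)"
    using chi_square_exponent_bound [OF t] s by (intro ennreal_leI power_mono) (auto simp: s_def)
  also have "exp (4 * t\<^sup>2) ^ N = exp (4 * t\<^sup>2 * real N)"
    by (simp add: exp_of_nat_mult [symmetric] mult.commute)
  finally show ?thesis .
qed

lemma P_norm_concentration:
  assumes "\<delta> > 0"
  shows "measure P {g \<in> space P. \<bar>r2 g - real N\<bar> \<ge> \<delta> * real N}
    \<le> 2 * exp (- (min (1/4) (\<delta> / (2 * 4)) * \<delta> / 2 * real N))"
proof -
  interpret prob_space P by (rule prob_space_P)
  show ?thesis
  proof (rule exponential_concentration)
    show "(\<lambda>g. r2 g - real N) \<in> borel_measurable P" by measurable
  qed (use assms nn_integral_P_exp_norm in auto)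
qed

text \<open>From x \<le> exp x at x = t r2. The choice t = 1/(4N) makes t N = 1/4 and 4 t^2 N \<le>
  1/4, so the constant is at most 4 exp(1/2) \<le> 8. Only the order \<open>N\<close> matters
  later.\<close>

lemma P_norm_moment:
  shows "integrable P r2" "(\<integral>g. r2 g \<partial>P) \<le> 8 * real N"
proof -
  define t where "t = 1 / (4 * real N)"
  have t: "\<bar>t\<bar> \<le> 1/4" using N_pos by (simp add: t_def)
  have [measurable]: "r2 \<in> borel_measurable G" by measurable
  have pt: "r2 g \<le> 4 * real N * exp (1/4) * exp (t * (r2 g - real N))" for g :: "nat \<Rightarrow> real"
  proof -
    have "t * r2 g \<le> exp (t * r2 g)" using exp_ge_add_one_self [of "t * r2 g"] by linarith
    also have "t * r2 g = 1/4 + t * (r2 g - real N)" using N_pos by (simp add: t_def field_simps)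
    finally show ?thesis using N_pos by (simp add: t_def exp_add [symmetric] field_simps)
  qed
  have "(\<integral>\<^sup>+g. ennreal (r2 g) \<partial>P)
      \<le> (\<integral>\<^sup>+g. ennreal (4 * real N * exp (1/4)) * ennreal (exp (t * (r2 g - real N))) \<partial>P)"
    using pt by (intro nn_integral_mono) (simp add: ennreal_mult' [symmetric] ennreal_leI)
  also have "\<dots> = ennreal (4 * real N * exp (1/4)) * (\<integral>\<^sup>+g. ennreal (exp (t * (r2 g - real N))) \<partial>P)"
    by (subst nn_integral_cmult) auto
  also have "\<dots> \<le> ennreal (4 * real N * exp (1/4)) * ennreal (exp (4 * t\<^sup>2 * real N))"
    by (intro mult_left_mono nn_integral_P_exp_norm t) auto
  also have "\<dots> = ennreal (4 * real N * (exp (1/4) * exp (4 * t\<^sup>2 * real N)))"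
    by (simp add: ennreal_mult' [symmetric])
  also have "\<dots> \<le> ennreal (8 * real N)"
  proof -
    have "4 * t\<^sup>2 * real N \<le> 1/4"
      using N_pos by (simp add: t_def power2_eq_square field_simps)
    then have "exp (1/4) * exp (4 * t\<^sup>2 * real N) \<le> exp (1/2)"
      by (simp add: exp_add [symmetric])
    also have "exp (1/2 :: real) \<le> 1 + 1/2 + (1/2)\<^sup>2" by (intro exp_bound) auto
    finally have "exp (1/4) * exp (4 * t\<^sup>2 * real N) \<le> 2" by (simp add: power2_eq_square)
    then have "4 * real N * (exp (1/4) * exp (4 * t\<^sup>2 * real N)) \<le> 4 * real N * 2"
      by (intro mult_left_mono) auto
    then show ?thesis by (intro ennreal_leI) simp
  qed
  finally have le: "(\<integral>\<^sup>+g. ennreal (r2 g) \<partial>P) \<le> ennreal (8 * real N)" .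
  have nn: "0 \<le> r2 g" for g by (intro sum_nonneg) auto
  show int: "integrable P r2"
    using le nn by (intro integrableI_nonneg) (auto intro: le_less_trans)
  then have "ennreal (\<integral>g. r2 g \<partial>P) \<le> ennreal (8 * real N)"
    using le nn by (subst nn_integral_eq_integral [symmetric]) auto
  then show "(\<integral>g. r2 g \<partial>P) \<le> 8 * real N" by (simp add: ennreal_le_iff)
qed

text \<open>\<open>F\<close> is unbounded, so a small probability of deviation is not enough. On the
  bad event one uses |F - m| \<le> \<epsilon> (F - m)^2 + 1/(4\<epsilon>), and linear growth of
  \<open>f\<close> bounds the second moment by that of the norm; 32 is 4 times the 8 of
  \<open>P_norm_moment\<close>.\<close>

lemma gibbs_mean_approx:
  fixes f :: "real \<Rightarrow> real" and m \<eta> \<epsilon> :: real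
  assumes lip: "1-lipschitz_on UNIV f" and pos: "\<eta> > 0" "\<epsilon> > 0"
  defines "F \<equiv> \<lambda>g. 1 / real N * (\<Sum>i\<in>{1..N}. f (g i))"
  shows "\<bar>gibbs_mean N a \<theta> F - m\<bar> \<le> \<eta> + \<epsilon> * (2 * m\<^sup>2 + 4 * (f 0)\<^sup>2 + 32)
    + measure P {g \<in> space P. \<bar>F g - m\<bar> \<ge> \<eta>} / (4 * \<epsilon>)"
proof -
  interpret prob_space P by (rule prob_space_P)
  have [measurable]: "f \<in> borel_measurable borel"
    using lipschitz_on_continuous_on [OF lip] by (rule borel_measurable_continuous_onI)
  have [measurable]: "F \<in> borel_measurable G" unfolding F_def by measurable
  define B where "B = {g \<in> space P. \<bar>F g - m\<bar> \<ge> \<eta>}"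
  have [measurable]: "B \<in> sets G" unfolding B_def space_P by measurable
  have sq: "(x + y)\<^sup>2 \<le> 2 * x\<^sup>2 + 2 * y\<^sup>2" for x y :: real
    using zero_le_power2 [of "x - y"] by (simp add: power2_sum power2_diff)
  have f2: "(f x)\<^sup>2 \<le> 2 * (f 0)\<^sup>2 + 2 * x\<^sup>2" for x
  proof -
    have "\<bar>f x - f 0\<bar> \<le> \<bar>x\<bar>" using lipschitz_onD [OF lip, of x 0] by (simp add: dist_real_def)
    then have "(f x - f 0)\<^sup>2 \<le> x\<^sup>2" by (simp add: abs_le_square_iff)
    then show ?thesis using sq [of "f 0" "f x - f 0"] by simp
  qed
  have F2: "(F g)\<^sup>2 \<le> 2 * (f 0)\<^sup>2 + 2 / real N * r2 g" for g
  proof -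
    have "(\<Sum>i\<in>{1..N}. f (g i))\<^sup>2 \<le> real N * (\<Sum>i\<in>{1..N}. (f (g i))\<^sup>2)"
      using sum_squared_le_sum_of_squares [of "\<lambda>i. f (g i)" "{1..N}"] by (simp add: mult.commute)
    also have "\<dots> \<le> real N * (\<Sum>i\<in>{1..N}. 2 * (f 0)\<^sup>2 + 2 * (g i)\<^sup>2)"
      by (intro mult_left_mono sum_mono f2) auto
    also have "\<dots> = real N * (real N * (2 * (f 0)\<^sup>2) + 2 * r2 g)"
      by (simp add: sum.distrib sum_distrib_left)
    finally show ?thesis
      using N_pos by (simp add: F_def power_divide field_simps power2_eq_square)
  qed
  have d2: "(F g - m)\<^sup>2 \<le> 2 * m\<^sup>2 + 4 * (f 0)\<^sup>2 + 4 / real N * r2 g" for g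
    using sq [of "F g" "- m"] F2 [of g] by simp
  have pt: "\<bar>F g - m\<bar> \<le> \<eta> + \<epsilon> * (2 * m\<^sup>2 + 4 * (f 0)\<^sup>2 + 4 / real N * r2 g) + indicator B g / (4 * \<epsilon>)"
    if "g \<in> space P" for g
  proof (cases "g \<in> B")
    case True
    have "0 \<le> (2 * \<epsilon> * \<bar>F g - m\<bar> - 1)\<^sup>2 / (4 * \<epsilon>)" using pos by simp
    also have "\<dots> = \<epsilon> * (F g - m)\<^sup>2 - \<bar>F g - m\<bar> + 1 / (4 * \<epsilon>)"
      using pos by (simp add: power2_diff power_mult_distrib field_simps power2_eq_square [of \<epsilon>])
    finally have "\<bar>F g - m\<bar> \<le> \<epsilon> * (F g - m)\<^sup>2 + 1 / (4 * \<epsilon>)" by linarith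
    also have "\<epsilon> * (F g - m)\<^sup>2 \<le> \<epsilon> * (2 * m\<^sup>2 + 4 * (f 0)\<^sup>2 + 4 / real N * r2 g)"
      using pos d2 [of g] by (intro mult_left_mono) auto
    finally show ?thesis using True pos by simp
  next
    case False
    have "0 \<le> \<epsilon> * (2 * m\<^sup>2 + 4 * (f 0)\<^sup>2 + 4 / real N * r2 g)"
      using pos by (intro mult_nonneg_nonneg add_nonneg_nonneg sum_nonneg) auto
    then show ?thesis using False that by (simp add: B_def)
  qed
  have intr: "integrable P (\<lambda>g. \<eta> + \<epsilon> * (2 * m\<^sup>2 + 4 * (f 0)\<^sup>2 + 4 / real N * r2 g) + indicator B g / (4 * \<epsilon>))"
    using P_norm_moment(1) by (intro Bochner_Integration.integrable_add integrable_mult_right integrable_const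
        integrable_divide_zero integrable_real_indicator) (auto simp: emeasure_eq_measure)
  \<comment> \<open>The pointwise bound \<open>pt\<close> is itself an integrable majorant, since
    \<open>r2\<close> is integrable.\<close>
  have intF: "integrable P (\<lambda>g. F g - m)"
    by (rule Bochner_Integration.integrable_bound [OF intr]) (auto intro!: AE_I2 order.trans [OF pt])
  then have intF': "integrable P F"
    using Bochner_Integration.integrable_add [OF intF integrable_const [of m]] by simp
  have "\<bar>gibbs_mean N a \<theta> F - m\<bar> = \<bar>\<integral>g. F g - m \<partial>P\<bar>"
    using intF' by (simp add: gibbs_mean_eq prob_space del: space_P)
  also have "\<dots> \<le> (\<integral>g. \<bar>F g - m\<bar> \<partial>P)" by (rule integral_abs_bound)
  also have "\<dots> \<le> (\<integral>g. \<eta> + \<epsilon> * (2 * m\<^sup>2 + 4 * (f 0)\<^sup>2 + 4 / real N * r2 g) + indicator B g / (4 * \<epsilon>) \<partial>P)"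
    using intF by (intro integral_mono intr pt) auto
  also have "\<dots> = \<eta> + \<epsilon> * (2 * m\<^sup>2 + 4 * (f 0)\<^sup>2 + 4 / real N * (\<integral>g. r2 g \<partial>P)) + prob B / (4 * \<epsilon>)"
    using P_norm_moment(1) by (simp add: prob_space emeasure_eq_measure del: space_P)
  also have "\<dots> \<le> \<eta> + \<epsilon> * (2 * m\<^sup>2 + 4 * (f 0)\<^sup>2 + 32) + prob B / (4 * \<epsilon>)"
  proof -
    have "4 / real N * (\<integral>g. r2 g \<partial>P) \<le> 4 / real N * (8 * real N)"
      by (intro mult_left_mono P_norm_moment(2)) auto
    also have "\<dots> = 32" using N_pos by simp
    finally show ?thesis using pos by (intro add_mono mult_left_mono) auto
  qed
  finally show ?thesis unfolding B_def .
qed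

end

section \<open>The tilted product measure and its comparison with the Gibbs measure\<close>

locale tilted_product = bounded_spectrum +
  fixes K b :: real and s :: "nat \<Rightarrow> real"
  assumes s_pos: "\<And>i. i \<in> {1..N} \<Longrightarrow> s i > 0"
    and s_le: "\<And>i. i \<in> {1..N} \<Longrightarrow> s i \<le> b"
    and s_eq: "\<And>i. i \<in> {1..N} \<Longrightarrow> 1 / (s i)\<^sup>2 = 2 * \<theta> * (K - a i)"
begin

text \<open>\<open>q\<close> is the density dQ/dG, where the \<open>s i\<close> are the standard
  deviations of the factors of Q. \<open>E0\<close> collects the factors of the Gibbs weight
  relative to \<open>q\<close> that do not depend on \<open>g\<close>, and \<open>A\<close> is the
  constant of the error A \<delta> N on the shell: |H| \<le> c N accounts for its first term, the
  normalisation of the norm for its second.\<close>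

definition "q g = (\<Prod>i\<in>{1..N}. normal_ratio (s i) (g i))"
definition "A = \<bar>\<theta>\<bar> * c + \<bar>\<theta> * K - 1/2\<bar>"
definition "E0 = exp ((\<theta> * K - 1/2) * real N) * (\<Prod>i\<in>{1..N}. s i)"

lemma q_pos: "q g > 0"
  unfolding q_def using s_pos by (intro prod_pos normal_ratio_pos) auto

lemma E0_pos: "E0 > 0"
  unfolding E0_def using s_pos by (intro mult_pos_pos prod_pos) auto

lemma q_measurable [measurable]: "q \<in> borel_measurable G"
  unfolding q_def std_gaussian_eq by measurable

text \<open>Because \<Sum> a_i g_i^2 = H r2 / N, the logarithm of \<open>q\<close> is explicit in
  \<open>H\<close> and \<open>r2\<close>. The identity is exact, and the leftover exponent vanishes
  on the sphere r2 = N.\<close>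

lemma weight_eq:
  "exp (\<theta> * H g) = E0 * q g * exp (\<theta> * H g * (1 - r2 g / real N) + (\<theta> * K - 1/2) * (r2 g - real N))"
proof -
  have "(\<Prod>i\<in>{1..N}. s i) * q g = exp (\<Sum>i\<in>{1..N}. (1 - 2 * \<theta> * (K - a i)) * (g i)\<^sup>2 / 2)"
    unfolding q_def prod.distrib [symmetric] exp_sum [OF finite_atLeastAtMost]
  proof (intro prod.cong refl)
    fix i assume i: "i \<in> {1..N}"
    show "s i * normal_ratio (s i) (g i) = exp ((1 - 2 * \<theta> * (K - a i)) * (g i)\<^sup>2 / 2)"
      unfolding normal_ratio_def s_eq [OF i] using s_pos [OF i] by simp
  qed
  also have "(\<Sum>i\<in>{1..N}. (1 - 2 * \<theta> * (K - a i)) * (g i)\<^sup>2 / 2)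
      = (1/2 - \<theta> * K) * r2 g + \<theta> * (\<Sum>i\<in>{1..N}. a i * (g i)\<^sup>2)"
    unfolding sum_distrib_left sum.distrib [symmetric] by (intro sum.cong refl) (simp add: field_simps)
  also have "(\<Sum>i\<in>{1..N}. a i * (g i)\<^sup>2) = H g * r2 g / real N"
    using hamiltonian_times_norm [of N a g] N_pos by simp
  finally have q: "(\<Prod>i\<in>{1..N}. s i) * q g = exp ((1/2 - \<theta> * K) * r2 g + \<theta> * (H g * r2 g / real N))" .
  have "E0 * q g * exp (\<theta> * H g * (1 - r2 g / real N) + (\<theta> * K - 1/2) * (r2 g - real N))
      = exp ((\<theta> * K - 1/2) * real N) * ((\<Prod>i\<in>{1..N}. s i) * q g)
        * exp (\<theta> * H g * (1 - r2 g / real N) + (\<theta> * K - 1/2) * (r2 g - real N))"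
    by (simp add: E0_def)
  also have "\<dots> = exp (\<theta> * H g)"
    unfolding q by (simp add: exp_add [symmetric] algebra_simps)
  finally show ?thesis ..
qed

lemma weight_bounds:
  assumes "\<bar>r2 g - real N\<bar> \<le> \<delta> * real N"
  shows "exp (\<theta> * H g) \<le> E0 * q g * exp (A * \<delta> * real N)"
    and "E0 * q g * exp (- (A * \<delta> * real N)) \<le> exp (\<theta> * H g)"
proof -
  let ?e = "\<theta> * H g * (1 - r2 g / real N) + (\<theta> * K - 1/2) * (r2 g - real N)"
  have "\<bar>?e\<bar> \<le> \<bar>\<theta>\<bar> * \<bar>H g\<bar> * (\<bar>r2 g - real N\<bar> / real N) + \<bar>\<theta> * K - 1/2\<bar> * \<bar>r2 g - real N\<bar>"
  proof -
    have "\<bar>1 - r2 g / real N\<bar> = \<bar>r2 g - real N\<bar> / real N"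
      using N_pos by (simp add: abs_if field_simps)
    then show ?thesis
      by (intro order.trans [OF abs_triangle_ineq]) (simp add: abs_mult)
  qed
  also have "\<dots> \<le> \<bar>\<theta>\<bar> * (c * real N) * (\<delta> * real N / real N) + \<bar>\<theta> * K - 1/2\<bar> * (\<delta> * real N)"
    using assms abs_H_le c_nonneg by (intro add_mono mult_mono divide_right_mono) auto
  also have "\<dots> = A * \<delta> * real N"
    using N_pos by (simp add: A_def algebra_simps)
  finally have e: "\<bar>?e\<bar> \<le> A * \<delta> * real N" .
  show "exp (\<theta> * H g) \<le> E0 * q g * exp (A * \<delta> * real N)"
    unfolding weight_eq [of g] using e E0_pos q_pos [of g] by (intro mult_left_mono) auto
  show "E0 * q g * exp (- (A * \<delta> * real N)) \<le> exp (\<theta> * H g)"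
    unfolding weight_eq [of g] using e E0_pos q_pos [of g] by (intro mult_left_mono) auto
qed

definition tilt_map :: "(nat \<Rightarrow> real) \<Rightarrow> nat \<Rightarrow> real" where
  "tilt_map g = (\<lambda>i\<in>{1..N}. s i * g i)"

lemma tilt_map_measurable [measurable]: "tilt_map \<in> measurable G G"
  unfolding tilt_map_def by measurable

text \<open>As an image of \<open>G\<close>, events under \<open>Q\<close> become events about
  independent standard normals (\<open>measure_Q\<close>); the density form is recovered in
  \<open>emeasure_Q\<close>.\<close>

definition "Q = distr G G tilt_map"

lemma prob_space_Q: "prob_space Q"
  unfolding Q_def by (intro prob_space.prob_space_distr prob_space_std_gaussian) measurable

lemma sets_Q [measurable_cong, simp]: "sets Q = sets G" and space_Q [simp]: "space Q = space G"
  by (simp_all add: Q_def)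

lemma emeasure_Q:
  assumes "B \<in> sets G"
  shows "emeasure Q B = (\<integral>\<^sup>+g. ennreal (q g) * indicator B g \<partial>G)"
proof -
  have "emeasure Q B = (\<integral>\<^sup>+g. indicator B (tilt_map g) \<partial>G)"
    using assms by (subst nn_integral_indicator [symmetric]) (auto simp: Q_def nn_integral_distr simp del: nn_integral_indicator)
  also have "\<dots> = (\<integral>\<^sup>+g. ennreal (q g) * indicator B g \<partial>G)"
    unfolding tilt_map_def q_def std_gaussian_eq using s_pos assms
    by (intro nn_integral_PiM_std_normal_scale) (auto simp: std_gaussian_eq)
  finally show ?thesis .
qed

text \<open>The upper bound on the weight estimates the Gibbs mass of \<open>B\<close> in the shell
  by Q(B), the lower bound estimates \<open>Z\<close> from below by Q(shell). Multiplying the two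
  cancels \<open>E0\<close> and \<open>Z\<close>; each bound contributes one factor exp(A \<delta>
  N).\<close>

lemma P_le_Q_on_shell:
  assumes B [measurable]: "B \<in> sets G"
  defines "\<And>\<delta>. Sh \<delta> \<equiv> {g \<in> space G. \<bar>r2 g - real N\<bar> < \<delta> * real N}"
  shows "measure P (B \<inter> Sh \<delta>) * measure Q (Sh \<delta>) \<le> exp (2 * A * \<delta> * real N) * measure Q B"
proof -
  interpret P: prob_space P by (rule prob_space_P)
  interpret Q: prob_space Q by (rule prob_space_Q)
  let ?e = "exp (A * \<delta> * real N)"
  have [measurable]: "Sh \<delta> \<in> sets G" unfolding Sh_def by measurable
  have P: "emeasure P X * ennreal Z = (\<integral>\<^sup>+g. ennreal (exp (\<theta> * H g)) * indicator X g \<partial>G)"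
    if [measurable]: "X \<in> sets G" for X
    using Z_pos nn_integral_P [of "indicator X"] that
    by (simp add: ennreal_divide_times)
  have "emeasure P (B \<inter> Sh \<delta>) * ennreal Z
      = (\<integral>\<^sup>+g. ennreal (exp (\<theta> * H g)) * indicator (B \<inter> Sh \<delta>) g \<partial>G)"
    by (rule P) measurable
  also have "\<dots> \<le> (\<integral>\<^sup>+g. ennreal (E0 * ?e) * (ennreal (q g) * indicator B g) \<partial>G)"
  proof (rule nn_integral_mono)
    fix g
    show "ennreal (exp (\<theta> * H g)) * indicator (B \<inter> Sh \<delta>) g
        \<le> ennreal (E0 * ?e) * (ennreal (q g) * indicator B g)"
      using weight_bounds(1) [of g \<delta>] E0_pos q_pos [of g]
      by (auto simp: indicator_def Sh_def ennreal_mult' [symmetric] mult_ac intro!: ennreal_leI)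
  qed
  also have "\<dots> = ennreal (E0 * ?e) * emeasure Q B"
    by (subst nn_integral_cmult) (auto simp: emeasure_Q)
  finally have 1: "measure P (B \<inter> Sh \<delta>) * Z \<le> E0 * ?e * measure Q B"
    using Z_pos E0_pos by (simp add: P.emeasure_eq_measure Q.emeasure_eq_measure ennreal_mult' [symmetric] ennreal_le_iff)
  \<comment> \<open>The partition function is never computed; the contribution of the shell alone
    bounds it from below.\<close>
  have "ennreal (E0 / ?e) * emeasure Q (Sh \<delta>)
      = (\<integral>\<^sup>+g. ennreal (E0 / ?e) * (ennreal (q g) * indicator (Sh \<delta>) g) \<partial>G)"
    by (subst nn_integral_cmult) (auto simp: emeasure_Q)
  also have "\<dots> \<le> (\<integral>\<^sup>+g. ennreal (exp (\<theta> * H g)) * indicator (Sh \<delta>) g \<partial>G)"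
  proof (rule nn_integral_mono)
    fix g
    show "ennreal (E0 / ?e) * (ennreal (q g) * indicator (Sh \<delta>) g)
        \<le> ennreal (exp (\<theta> * H g)) * indicator (Sh \<delta>) g"
      using weight_bounds(2) [of g \<delta>] E0_pos q_pos [of g]
      by (auto simp: indicator_def Sh_def ennreal_mult' [symmetric] exp_minus divide_inverse mult_ac intro!: ennreal_leI)
  qed
  also have "\<dots> = emeasure P (Sh \<delta>) * ennreal Z" by (rule P [symmetric]) measurable
  also have "\<dots> \<le> 1 * ennreal Z" by (intro mult_right_mono) (auto simp: P.emeasure_le_1)
  finally have 2: "E0 / ?e * measure Q (Sh \<delta>) \<le> Z"
    using Z_pos E0_pos by (simp add: P.emeasure_eq_measure Q.emeasure_eq_measure ennreal_mult' [symmetric] ennreal_le_iff)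
  have "measure P (B \<inter> Sh \<delta>) * (E0 / ?e * measure Q (Sh \<delta>)) \<le> measure P (B \<inter> Sh \<delta>) * Z"
    by (intro mult_left_mono 2) auto
  also note 1
  finally have "E0 * (measure P (B \<inter> Sh \<delta>) * measure Q (Sh \<delta>)) \<le> E0 * (?e * ?e * measure Q B)"
    by (simp add: field_simps)
  then have "measure P (B \<inter> Sh \<delta>) * measure Q (Sh \<delta>) \<le> ?e * ?e * measure Q B"
    using E0_pos by simp
  also have "?e * ?e = exp (2 * A * \<delta> * real N)" by (simp add: exp_add [symmetric])
  finally show ?thesis .
qed

lemma measure_Q:
  assumes [measurable]: "Measurable.pred G R"
  shows "measure Q {g \<in> space G. R g} = measure G {g \<in> space G. R (tilt_map g)}"
proof -
  have "tilt_map -` {g \<in> space G. R g} \<inter> space G = {g \<in> space G. R (tilt_map g)}"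
    using measurable_space [OF tilt_map_measurable] by auto
  then show ?thesis unfolding Q_def by (subst measure_distr) auto
qed

text \<open>The deviation of r2 from N is a centred weighted chi-squared sum plus the error of the
  mean variance. The hypothesis lets the latter take half of \<delta>, and the former must exceed
  the other half.\<close>

lemma Q_norm_concentration:
  assumes "\<delta> > 0" and "\<bar>(\<Sum>i\<in>{1..N}. (s i)\<^sup>2) - real N\<bar> \<le> \<delta> / 2 * real N"
  shows "1 - measure Q {g \<in> space G. \<bar>r2 g - real N\<bar> < \<delta> * real N}
    \<le> 2 * exp (- (min (1 / (4 * b\<^sup>2)) ((\<delta> / 2) / (2 * (4 * b ^ 4))) * (\<delta> / 2) / 2 * real N))"
proof -
  interpret Q: prob_space Q by (rule prob_space_Q)
  interpret G: prob_space G by (rule prob_space_std_gaussian)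
  let ?Sh = "{g \<in> space G. \<bar>r2 g - real N\<bar> < \<delta> * real N}"
  have [measurable]: "?Sh \<in> sets G" by measurable
  have b: "b > 0" using s_pos [of 1] s_le [of 1] N_pos by auto
  have "1 - measure Q ?Sh = measure Q (space Q - ?Sh)" by (subst Q.prob_compl) auto
  also have "space Q - ?Sh = {g \<in> space G. \<bar>r2 g - real N\<bar> \<ge> \<delta> * real N}" by auto
  also have "measure Q \<dots> = measure G {g \<in> space G. \<bar>r2 (tilt_map g) - real N\<bar> \<ge> \<delta> * real N}"
    by (rule measure_Q) measurable
  also have "\<dots> \<le> measure G {g \<in> space G. \<bar>\<Sum>i\<in>{1..N}. (s i)\<^sup>2 * ((g i)\<^sup>2 - 1)\<bar> \<ge> \<delta> / 2 * real N}"
  proof (rule G.finite_measure_mono)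
    have eq: "r2 (tilt_map g) - real N = (\<Sum>i\<in>{1..N}. (s i)\<^sup>2 * ((g i)\<^sup>2 - 1)) + ((\<Sum>i\<in>{1..N}. (s i)\<^sup>2) - real N)" for g
      by (simp add: tilt_map_def sum.distrib [symmetric] power_mult_distrib algebra_simps)
    have "\<bar>\<Sum>i\<in>{1..N}. (s i)\<^sup>2 * ((g i)\<^sup>2 - 1)\<bar> \<ge> \<delta> / 2 * real N"
      if "\<bar>r2 (tilt_map g) - real N\<bar> \<ge> \<delta> * real N" for g
      using assms(2) that [unfolded eq]
        abs_triangle_ineq [of "\<Sum>i\<in>{1..N}. (s i)\<^sup>2 * ((g i)\<^sup>2 - 1)" "(\<Sum>i\<in>{1..N}. (s i)\<^sup>2) - real N"]
      by linarith
    then show "{g \<in> space G. \<bar>r2 (tilt_map g) - real N\<bar> \<ge> \<delta> * real N}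
        \<subseteq> {g \<in> space G. \<bar>\<Sum>i\<in>{1..N}. (s i)\<^sup>2 * ((g i)\<^sup>2 - 1)\<bar> \<ge> \<delta> / 2 * real N}"
      by blast
    show "{g \<in> space G. \<bar>\<Sum>i\<in>{1..N}. (s i)\<^sup>2 * ((g i)\<^sup>2 - 1)\<bar> \<ge> \<delta> / 2 * real N} \<in> sets G"
      by measurable
  qed
  also have "\<dots> \<le> 2 * exp (- (min (1 / (4 * b\<^sup>2)) ((\<delta> / 2) / (2 * (4 * b ^ 4))) * (\<delta> / 2) / 2 * real N))"
  proof (rule std_gaussian_sum_concentration)
    \<comment> \<open>The weight (s i)^2 \<le> b^2 is absorbed into \<open>t\<close>: the range 1/4
      shrinks to 1/(4 b^2) and the constant 4 grows to 4 b^4, uniformly in \<open>i\<close>.\<close>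
    fix i t assume i: "i \<in> {1..N}" and t: "\<bar>t\<bar> \<le> 1 / (4 * b\<^sup>2)"
    have sb: "(s i)\<^sup>2 \<le> b\<^sup>2" using s_pos [OF i] s_le [OF i] by (intro power_mono) auto
    have "\<bar>t * (s i)\<^sup>2\<bar> \<le> \<bar>t\<bar> * b\<^sup>2" unfolding abs_mult using sb by (intro mult_left_mono) auto
    also have "\<dots> \<le> 1 / (4 * b\<^sup>2) * b\<^sup>2" using t by (intro mult_right_mono) auto
    also have "\<dots> = 1/4" using b by simp
    finally have "(\<integral>\<^sup>+x. ennreal (exp ((t * (s i)\<^sup>2) * (x\<^sup>2 - 1))) \<partial>std_normal)
        \<le> ennreal (exp (4 * (t * (s i)\<^sup>2)\<^sup>2))"
      by (rule nn_integral_std_normal_centred_square)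
    also have "\<dots> \<le> ennreal (exp (4 * b ^ 4 * t\<^sup>2))"
    proof -
      have "((s i)\<^sup>2)\<^sup>2 \<le> (b\<^sup>2)\<^sup>2" by (rule power_mono [OF sb]) simp
      then have "t\<^sup>2 * ((s i)\<^sup>2)\<^sup>2 \<le> t\<^sup>2 * (b\<^sup>2)\<^sup>2" by (intro mult_left_mono) auto
      then show ?thesis by (intro ennreal_leI) (simp add: power_mult_distrib mult_ac)
    qed
    finally show "(\<integral>\<^sup>+x. ennreal (exp (t * ((s i)\<^sup>2 * (x\<^sup>2 - 1)))) \<partial>std_normal)
        \<le> ennreal (exp (4 * b ^ 4 * t\<^sup>2))" by (simp add: mult.assoc)
  qed (use assms b in auto)
  finally show ?thesis .
qed

end

section \<open>Lipschitz functions of a normal variable\<close>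

lemma lipschitz_1_abs_diff_le:
  fixes f :: "real \<Rightarrow> real"
  assumes "1-lipschitz_on UNIV f"
  shows "\<bar>f x - f y\<bar> \<le> \<bar>x - y\<bar>"
  using lipschitz_onD [OF assms, of x y] by (simp add: dist_real_def)

lemma lipschitz_1_borel_measurable:
  fixes f :: "real \<Rightarrow> real"
  assumes "1-lipschitz_on UNIV f"
  shows "f \<in> borel_measurable borel"
  using lipschitz_on_continuous_on [OF assms] by (rule borel_measurable_continuous_onI)

lemma integrable_std_normal_abs: "integrable std_normal (\<lambda>x. \<bar>x\<bar>)"
  using integrable_std_normal_moment_abs [of 1] by (subst integrable_density) auto

lemma integral_std_normal_abs_le: "(\<integral>x. \<bar>x\<bar> \<partial>std_normal) \<le> 1"
proof -
  have "(\<integral>x. \<bar>x\<bar> \<partial>std_normal) = sqrt (2 / pi)"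
    using integral_std_normal_moment_abs_odd [of 0] by (subst integral_density) auto
  also have "\<dots> \<le> 1" using pi_gt3 by simp
  finally show ?thesis .
qed

lemma integrable_std_normal_lipschitz:
  fixes f :: "real \<Rightarrow> real"
  assumes "1-lipschitz_on UNIV f"
  shows "integrable std_normal (\<lambda>x. f (s * x))"
proof -
  interpret prob_space std_normal by (rule prob_space_std_normal)
  note [measurable] = lipschitz_1_borel_measurable [OF assms]
  show ?thesis
  proof (rule Bochner_Integration.integrable_bound)
    show "integrable std_normal (\<lambda>x. \<bar>f 0\<bar> + \<bar>s\<bar> * \<bar>x\<bar>)"
      using integrable_std_normal_abs by auto
    have "\<bar>f (s * x)\<bar> \<le> \<bar>f 0\<bar> + \<bar>s\<bar> * \<bar>x\<bar>" for x
      using lipschitz_1_abs_diff_le [OF assms, of "s * x" 0] by (simp add: abs_mult)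
    then show "AE x in std_normal. norm (f (s * x)) \<le> norm (\<bar>f 0\<bar> + \<bar>s\<bar> * \<bar>x\<bar>)"
      by simp
  qed measurable
qed

text \<open>The two normal laws are coupled through the same \<open>x\<close>, whose mean absolute
  value is at most 1. This makes the limiting mean Lipschitz in the standard deviation;
  \<open>t = 0\<close> bounds the centring constant in the next lemma.\<close>

lemma std_normal_mean_lipschitz:
  fixes f :: "real \<Rightarrow> real"
  assumes "1-lipschitz_on UNIV f"
  shows "\<bar>(\<integral>x. f (s * x) \<partial>std_normal) - (\<integral>x. f (t * x) \<partial>std_normal)\<bar> \<le> \<bar>s - t\<bar>"
proof -
  note int = integrable_std_normal_lipschitz [OF assms]
  have "\<bar>(\<integral>x. f (s * x) \<partial>std_normal) - (\<integral>x. f (t * x) \<partial>std_normal)\<bar>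
      = \<bar>\<integral>x. f (s * x) - f (t * x) \<partial>std_normal\<bar>"
    using int by simp
  also have "\<dots> \<le> (\<integral>x. \<bar>f (s * x) - f (t * x)\<bar> \<partial>std_normal)" by (rule integral_abs_bound)
  also have "\<dots> \<le> (\<integral>x. \<bar>s - t\<bar> * \<bar>x\<bar> \<partial>std_normal)"
  proof (rule integral_mono)
    show "integrable std_normal (\<lambda>x. \<bar>f (s * x) - f (t * x)\<bar>)" using int by auto
    show "integrable std_normal (\<lambda>x. \<bar>s - t\<bar> * \<bar>x\<bar>)" using integrable_std_normal_abs by auto
    show "\<bar>f (s * x) - f (t * x)\<bar> \<le> \<bar>s - t\<bar> * \<bar>x\<bar>" for x
      using lipschitz_1_abs_diff_le [OF assms, of "s * x" "t * x"]
      by (simp add: left_diff_distrib [symmetric] abs_mult)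
  qed
  also have "\<dots> = \<bar>s - t\<bar> * (\<integral>x. \<bar>x\<bar> \<partial>std_normal)" by (rule integral_mult_right_zero)
  also have "\<dots> \<le> \<bar>s - t\<bar> * 1" by (intro mult_left_mono integral_std_normal_abs_le) auto
  finally show ?thesis by simp
qed

text \<open>The centred variable is at most b + b |x| in absolute value, so its exponential moment
  has a bound depending on \<open>b\<close> only. The quadratic estimate is therefore uniform over
  all \<open>s \<le> b\<close>.\<close>

lemma nn_integral_exp_lipschitz_std_normal:
  fixes f :: "real \<Rightarrow> real"
  assumes f: "1-lipschitz_on UNIV f" and s: "0 < s" "s \<le> b" and t: "\<bar>t\<bar> \<le> 1/2"
  shows "(\<integral>\<^sup>+x. ennreal (exp (t * (f (s * x) - (\<integral>y. f (s * y) \<partial>std_normal)))) \<partial>std_normal)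
    \<le> ennreal (exp (4 * (exp b * (exp (b\<^sup>2) * sqrt 2)) * t\<^sup>2))"
proof -
  interpret prob_space std_normal by (rule prob_space_std_normal)
  note [measurable] = lipschitz_1_borel_measurable [OF f]
  define Y where "Y x = f (s * x) - (\<integral>y. f (s * y) \<partial>std_normal)" for x
  have Y: "integrable std_normal Y" "expectation Y = 0"
    unfolding Y_def using integrable_std_normal_lipschitz [OF f, of s] prob_space by auto
  have "\<bar>Y x\<bar> \<le> b + b * \<bar>x\<bar>" for x
  proof -
    have "\<bar>f (s * x) - f 0\<bar> \<le> s * \<bar>x\<bar>"
      using lipschitz_1_abs_diff_le [OF f, of "s * x" 0] s by (simp add: abs_mult)
    moreover have "\<bar>(\<integral>y. f (s * y) \<partial>std_normal) - f 0\<bar> \<le> s"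
      using std_normal_mean_lipschitz [OF f, of s 0] s prob_space by simp
    moreover have "s * \<bar>x\<bar> \<le> b * \<bar>x\<bar>" using s by (intro mult_right_mono) auto
    ultimately show ?thesis unfolding Y_def using s by linarith
  qed
  then have "(\<integral>\<^sup>+x. ennreal (exp \<bar>Y x\<bar>) \<partial>std_normal)
      \<le> (\<integral>\<^sup>+x. ennreal (exp b) * ennreal (exp (b * \<bar>x\<bar>)) \<partial>std_normal)"
    by (intro nn_integral_mono) (simp add: ennreal_mult' [symmetric] exp_add [symmetric])
  also have "\<dots> = ennreal (exp b) * (\<integral>\<^sup>+x. ennreal (exp (b * \<bar>x\<bar>)) \<partial>std_normal)"
    by (subst nn_integral_cmult) auto
  also have "\<dots> \<le> ennreal (exp b) * ennreal (exp (b\<^sup>2) * sqrt 2)"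
    by (intro mult_left_mono nn_integral_std_normal_exp_abs) auto
  also have "\<dots> = ennreal (exp b * (exp (b\<^sup>2) * sqrt 2))" by (simp add: ennreal_mult' [symmetric])
  finally show ?thesis
    using nn_integral_exp_centred_le [OF Y, of "exp b * (exp (b\<^sup>2) * sqrt 2)" t] t by (simp add: Y_def)
qed

section \<open>Deviations under the tilted product and their transfer to the Gibbs measure\<close>

context tilted_product
begin

text \<open>Pulled back to \<open>G\<close>, the centred average is a sum of independent centred
  terms. The rate depends on \<open>b\<close> and \<eta> only, so \<delta> can later be chosen
  against it before \<open>N\<close>.\<close>

lemma Q_mean_concentration:
  fixes f :: "real \<Rightarrow> real"
  assumes f: "1-lipschitz_on UNIV f" and \<eta>: "\<eta> > 0"
  shows "measure Q {g \<in> space G. \<bar>1 / real N * (\<Sum>i\<in>{1..N}. f (g i))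
      - 1 / real N * (\<Sum>i\<in>{1..N}. \<integral>x. f (s i * x) \<partial>std_normal)\<bar> \<ge> \<eta>}
    \<le> 2 * exp (- (min (1/2) (\<eta> / (2 * (4 * (exp b * (exp (b\<^sup>2) * sqrt 2))))) * \<eta> / 2 * real N))"
proof -
  note [measurable] = lipschitz_1_borel_measurable [OF f]
  let ?m = "\<lambda>i. \<integral>x. f (s i * x) \<partial>std_normal"
  have eq: "\<bar>1 / real N * (\<Sum>i\<in>{1..N}. f (tilt_map g i)) - 1 / real N * (\<Sum>i\<in>{1..N}. ?m i)\<bar> \<ge> \<eta>
      \<longleftrightarrow> \<bar>\<Sum>i\<in>{1..N}. f (s i * g i) - ?m i\<bar> \<ge> \<eta> * real N" for g
  proof -
    have "1 / real N * (\<Sum>i\<in>{1..N}. f (tilt_map g i)) - 1 / real N * (\<Sum>i\<in>{1..N}. ?m i)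
        = (\<Sum>i\<in>{1..N}. f (s i * g i) - ?m i) / real N"
      by (simp add: tilt_map_def sum_subtractf diff_divide_distrib)
    then show ?thesis
      using N_pos by (simp add: pos_le_divide_eq)
  qed
  have "measure Q {g \<in> space G. \<bar>1 / real N * (\<Sum>i\<in>{1..N}. f (g i)) - 1 / real N * (\<Sum>i\<in>{1..N}. ?m i)\<bar> \<ge> \<eta>}
      = measure G {g \<in> space G. \<bar>\<Sum>i\<in>{1..N}. f (s i * g i) - ?m i\<bar> \<ge> \<eta> * real N}"
    by (subst measure_Q) (measurable, simp only: eq)
  also have "\<dots> \<le> 2 * exp (- (min (1/2) (\<eta> / (2 * (4 * (exp b * (exp (b\<^sup>2) * sqrt 2))))) * \<eta> / 2 * real N))"
    using \<eta> s_pos s_le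
    by (intro std_gaussian_sum_concentration [where Y = "\<lambda>i x. f (s i * x) - ?m i"]
        nn_integral_exp_lipschitz_std_normal f) auto
  finally show ?thesis .
qed

text \<open>Off the shell the chi-squared bound applies; on it the comparison with \<open>Q\<close>
  does, and dividing by Q(shell) \<ge> 1/2 costs a factor 2. The bound is useful when Q(B) decays
  faster than exp(2 A \<delta> N) grows.\<close>

lemma P_bad_event:
  assumes B: "B \<in> sets G" and \<delta>: "\<delta> > 0"
    and half: "measure Q {g \<in> space G. \<bar>r2 g - real N\<bar> < \<delta> * real N} \<ge> 1/2"
  shows "measure P B \<le> 2 * exp (- (min (1/4) (\<delta> / (2 * 4)) * \<delta> / 2 * real N))
    + 2 * exp (2 * (\<bar>\<theta>\<bar> * c + \<bar>\<theta> * K - 1/2\<bar>) * \<delta> * real N) * measure Q B"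
proof -
  interpret P: prob_space P by (rule prob_space_P)
  let ?Sh = "{g \<in> space G. \<bar>r2 g - real N\<bar> < \<delta> * real N}"
  let ?Co = "{g \<in> space P. \<bar>r2 g - real N\<bar> \<ge> \<delta> * real N}"
  note [measurable] = B
  have [measurable]: "?Sh \<in> sets G" by measurable
  have Co: "?Co \<in> sets G" unfolding space_P by measurable
  have "measure P (B \<inter> ?Sh) * (1/2) \<le> measure P (B \<inter> ?Sh) * measure Q ?Sh"
    using half by (intro mult_left_mono) auto
  also have "\<dots> \<le> exp (2 * A * \<delta> * real N) * measure Q B"
    by (rule P_le_Q_on_shell [OF B])
  finally have 1: "measure P (B \<inter> ?Sh) \<le> 2 * exp (2 * A * \<delta> * real N) * measure Q B" by simp
  have "B \<subseteq> ?Co \<union> (B \<inter> ?Sh)"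
    using sets.sets_into_space [OF B] by auto
  then have "measure P B \<le> measure P (?Co \<union> (B \<inter> ?Sh))"
    using Co by (intro P.finite_measure_mono) auto
  also have "\<dots> \<le> measure P ?Co + measure P (B \<inter> ?Sh)"
    using Co by (intro measure_Un_le) auto
  also have "\<dots> \<le> 2 * exp (- (min (1/4) (\<delta> / (2 * 4)) * \<delta> / 2 * real N))
      + 2 * exp (2 * A * \<delta> * real N) * measure Q B"
    by (intro add_mono P_norm_concentration \<delta> 1)
  finally show ?thesis by (simp add: A_def)
qed

end

subsection \<open>Convergence in the Wasserstein metric\<close>

text \<open>The easy half of Kantorovich duality: under any coupling, the integrals of an
  L-Lipschitz function differ by at most L times the transport cost.\<close>

lemma wasserstein1_tendsto_mean:
  fixes u :: "real \<Rightarrow> real"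
  assumes c: "c \<ge> 0" and u: "L-lipschitz_on {0..c} u"
    and \<gamma>: "\<And>N i. N \<ge> 1 \<Longrightarrow> i \<in> {1..N} \<Longrightarrow> \<gamma> N i \<in> {0..c}"
    and \<rho>: "prob_space \<rho>" "sets \<rho> = sets borel" "emeasure \<rho> {0..c} = 1"
    and W: "(\<lambda>N. wasserstein1 (empirical_measure N (\<gamma> N)) \<rho>) \<longlonglongrightarrow> 0"
  shows "(\<lambda>N. 1 / real N * (\<Sum>i\<in>{1..N}. u (\<gamma> N i))) \<longlonglongrightarrow> (LINT x:{0..c}|\<rho>. u x)"
proof -
  interpret \<rho>: prob_space \<rho> by fact
  \<comment> \<open>\<open>u\<close> is controlled on \<open>{0..c}\<close> only, while a coupling
    lives on all pairs of reals. Clamping gives a bounded Lipschitz function on the line with the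
    same constant and unchanged on \<open>{0..c}\<close>.\<close>
  define w where "w x = u (max 0 (min c x))" for x
  have L: "L \<ge> 0" using u by (rule lipschitz_on_nonneg)
  have clamp: "max 0 (min c x) \<in> {0..c}" for x using c by auto
  have w_lip: "\<bar>w x - w y\<bar> \<le> L * \<bar>x - y\<bar>" for x y
  proof -
    have "\<bar>w x - w y\<bar> \<le> L * \<bar>max 0 (min c x) - max 0 (min c y)\<bar>"
      unfolding w_def using lipschitz_onD [OF u clamp clamp, of x y] by (simp add: dist_real_def)
    also have "\<dots> \<le> L * \<bar>x - y\<bar>" using L by (intro mult_left_mono) auto
    finally show ?thesis .
  qed
  then have "L-lipschitz_on UNIV w" using L by (intro lipschitz_onI) (auto simp: dist_real_def)
  then have [measurable]: "w \<in> borel_measurable borel"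
    using lipschitz_on_continuous_on borel_measurable_continuous_onI by blast
  have w_bd: "\<bar>w x\<bar> \<le> \<bar>u 0\<bar> + L * c" for x
  proof -
    have "\<bar>u (max 0 (min c x)) - u 0\<bar> \<le> L * \<bar>max 0 (min c x) - 0\<bar>"
      using lipschitz_onD [OF u clamp, of 0 x] c by (simp add: dist_real_def)
    also have "\<dots> \<le> L * c" using L c by (intro mult_left_mono) auto
    finally show ?thesis unfolding w_def by linarith
  qed
  have \<rho>_eq: "(LINT x:{0..c}|\<rho>. u x) = (\<integral>x. w x \<partial>\<rho>)"
  proof -
    have "(LINT x:{0..c}|\<rho>. u x) = (\<integral>x. indicator {0..c} x *\<^sub>R w x \<partial>\<rho>)"
      unfolding set_lebesgue_integral_def
      by (intro Bochner_Integration.integral_cong refl) (auto simp: w_def indicator_def max_def min_def)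
    also have "\<dots> = (\<integral>x. w x \<partial>\<rho>)"
    proof (rule integral_cong_AE)
      have "AE x in \<rho>. x \<in> {0..c}"
        using \<rho> by (intro \<rho>.AE_prob_1) (simp add: measure_def)
      then show "AE x in \<rho>. indicator {0..c} x *\<^sub>R w x = w x" by eventually_elim auto
    qed (auto simp: measurable_cong_sets [OF \<rho>(2) refl])
    finally show ?thesis .
  qed
  have emp_eq: "1 / real N * (\<Sum>i\<in>{1..N}. u (\<gamma> N i)) = (\<integral>x. w x \<partial>empirical_measure N (\<gamma> N))" if "N \<ge> 1" for N
  proof -
    have "(\<integral>x. w x \<partial>empirical_measure N (\<gamma> N)) = (\<integral>i. w (\<gamma> N i) \<partial>uniform_count_measure {1..N})"
      unfolding empirical_measure_def by (intro integral_distr) (auto simp: uniform_count_measure_def)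
    also have "\<dots> = (\<Sum>i\<in>{1..N}. w (\<gamma> N i)) / real N"
      by (subst integral_uniform_count_measure) auto
    also have "(\<Sum>i\<in>{1..N}. w (\<gamma> N i)) = (\<Sum>i\<in>{1..N}. u (\<gamma> N i))"
      using \<gamma> [OF that] by (intro sum.cong refl) (simp add: w_def)
    finally show ?thesis by simp
  qed
  have close: "\<bar>(\<integral>x. w x \<partial>\<mu>) - (\<integral>x. w x \<partial>\<rho>)\<bar> \<le> L * e"
    if \<mu>: "wasserstein1 \<mu> \<rho> < ennreal e" and e: "e > 0" for \<mu> e
  proof -
    obtain \<pi> where \<pi>: "\<pi> \<in> couplings \<mu> \<rho>" "(\<integral>\<^sup>+ p. ennreal \<bar>fst p - snd p\<bar> \<partial>\<pi>) < ennreal e"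
      using \<mu> unfolding wasserstein1_def INF_less_iff by auto
    have sets_\<pi>: "sets \<pi> = sets (borel \<Otimes>\<^sub>M borel)" and fst_\<pi>: "distr \<pi> borel fst = \<mu>"
      and snd_\<pi>: "distr \<pi> borel snd = \<rho>"
      using \<pi>(1) by (auto simp: couplings_def)
    note [measurable_cong] = sets_\<pi>
    have [measurable]: "fst \<in> measurable \<pi> borel" "snd \<in> measurable \<pi> borel"
      by (auto simp: measurable_cong_sets [OF sets_\<pi> refl])
    \<comment> \<open>\<open>couplings\<close> prescribes only the marginals; total mass one is
      inherited from \<rho>.\<close>
    interpret \<pi>: prob_space \<pi>
      using \<rho>(1) unfolding snd_\<pi> [symmetric] by (rule prob_space_distrD [rotated]) measurable
    have int1: "integrable \<pi> (\<lambda>p. \<bar>fst p - snd p\<bar>)"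
      using \<pi>(2) by (intro integrableI_nonneg) (auto intro: less_trans)
    have intw: "integrable \<pi> (\<lambda>p. w (fst p))" "integrable \<pi> (\<lambda>p. w (snd p))"
      by (rule \<pi>.integrable_const_bound [where B = "\<bar>u 0\<bar> + L * c"]; simp add: w_bd)+
    have "ennreal (\<integral>p. \<bar>fst p - snd p\<bar> \<partial>\<pi>) < ennreal e"
      using \<pi>(2) int1 by (subst nn_integral_eq_integral [symmetric]) auto
    then have le: "(\<integral>p. \<bar>fst p - snd p\<bar> \<partial>\<pi>) \<le> e" using e by (simp add: ennreal_less_iff)
    have "(\<integral>x. w x \<partial>\<mu>) - (\<integral>x. w x \<partial>\<rho>) = (\<integral>p. w (fst p) - w (snd p) \<partial>\<pi>)"
      unfolding fst_\<pi> [symmetric] snd_\<pi> [symmetric] using intw by (simp add: integral_distr)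
    also have "\<bar>\<dots>\<bar> \<le> (\<integral>p. \<bar>w (fst p) - w (snd p)\<bar> \<partial>\<pi>)" by (rule integral_abs_bound)
    also have "\<dots> \<le> (\<integral>p. L * \<bar>fst p - snd p\<bar> \<partial>\<pi>)"
      using intw int1 w_lip by (intro integral_mono) auto
    also have "\<dots> = L * (\<integral>p. \<bar>fst p - snd p\<bar> \<partial>\<pi>)" by (rule integral_mult_right_zero)
    also have "\<dots> \<le> L * e" using le L by (rule mult_left_mono)
    finally show ?thesis .
  qed
  show ?thesis
  proof (rule tendstoI)
    fix e :: real assume e: "e > 0"
    \<comment> \<open>The summand 1 covers the case L = 0 and makes \<open>L * d < e\<close>
      strict.\<close>
    define d where "d = e / (L + 1)"
    have d: "d > 0" "L * d < e" using e L by (auto simp: d_def field_simps)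
    have "eventually (\<lambda>N. wasserstein1 (empirical_measure N (\<gamma> N)) \<rho> < ennreal d) sequentially"
      using W d by (intro order_tendstoD) auto
    then show "\<forall>\<^sub>F N in sequentially. dist (1 / real N * (\<Sum>i\<in>{1..N}. u (\<gamma> N i))) (LINT x:{0..c}|\<rho>. u x) < e"
      using eventually_ge_at_top [of 1]
    proof eventually_elim
      case (elim N)
      then show ?case
        using close [OF elim(1) d(1)] d(2) emp_eq [of N] \<rho>_eq by (simp add: dist_real_def)
    qed
  qed
qed

subsection \<open>The Stieltjes transform\<close>

text \<open>Monotonicity turns the one-sided limit defining \<open>S_max\<close> into a supremum, so
  that a value below \<open>S_max\<close> is exceeded at an actual point z > c.\<close>

lemma Lim_at_right_antimono_ereal:
  fixes h :: "real \<Rightarrow> real"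
  assumes "\<And>x y. a < x \<Longrightarrow> x < y \<Longrightarrow> h y \<le> h x"
  shows "Lim (at_right a) (\<lambda>x. ereal (h x)) = (SUP x\<in>{a<..}. ereal (h x))"
proof (rule tendsto_Lim)
  show "((\<lambda>x. ereal (h x)) \<longlongrightarrow> (SUP x\<in>{a<..}. ereal (h x))) (at_right a)"
  proof (rule order_tendstoI)
    fix y assume "y < (SUP x\<in>{a<..}. ereal (h x))"
    then obtain z where z: "z > a" "y < ereal (h z)" by (auto simp: less_SUP_iff)
    have "eventually (\<lambda>x. x \<in> {a<..<z}) (at_right a)"
      using z(1) by (rule eventually_at_right_real)
    then show "eventually (\<lambda>x. y < ereal (h x)) (at_right a)"
    proof eventually_elim
      case (elim x)
      then have "ereal (h z) \<le> ereal (h x)" using assms [of x z] by simp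
      with z(2) show ?case by (rule less_le_trans)
    qed
  next
    fix y assume y: "(SUP x\<in>{a<..}. ereal (h x)) < y"
    have "eventually (\<lambda>x. x \<in> {a<..<a + 1}) (at_right a)"
      by (rule eventually_at_right_real) simp
    then show "eventually (\<lambda>x. ereal (h x) < y) (at_right a)"
    proof eventually_elim
      case (elim x)
      then have "ereal (h x) \<le> (SUP x\<in>{a<..}. ereal (h x))" by (intro SUP_upper) auto
      then show ?case using y by (rule le_less_trans)
    qed
  qed
qed simp

lemma Lim_at_left_antimono_ereal:
  fixes h :: "real \<Rightarrow> real"
  assumes "\<And>x y. x < y \<Longrightarrow> y < a \<Longrightarrow> h y \<le> h x"
  shows "Lim (at_left a) (\<lambda>x. ereal (h x)) = (INF x\<in>{..<a}. ereal (h x))"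
proof (rule tendsto_Lim)
  show "((\<lambda>x. ereal (h x)) \<longlongrightarrow> (INF x\<in>{..<a}. ereal (h x))) (at_left a)"
  proof (rule order_tendstoI)
    fix y assume "y > (INF x\<in>{..<a}. ereal (h x))"
    then obtain z where z: "z < a" "y > ereal (h z)" by (auto simp: INF_less_iff)
    have "eventually (\<lambda>x. x \<in> {z<..<a}) (at_left a)"
      using z(1) by (rule eventually_at_left_real)
    then show "eventually (\<lambda>x. y > ereal (h x)) (at_left a)"
    proof eventually_elim
      case (elim x)
      then have "ereal (h x) \<le> ereal (h z)" using assms [of z x] by simp
      then show ?case using z(2) by (rule le_less_trans)
    qed
  next
    fix y assume y: "y < (INF x\<in>{..<a}. ereal (h x))"
    have "eventually (\<lambda>x. x \<in> {a - 1<..<a}) (at_left a)"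
      by (rule eventually_at_left_real) simp
    then show "eventually (\<lambda>x. y < ereal (h x)) (at_left a)"
    proof eventually_elim
      case (elim x)
      then have "(INF x\<in>{..<a}. ereal (h x)) \<le> ereal (h x)" by (intro INF_lower) auto
      with y show ?case by (rule less_le_trans)
    qed
  qed
qed simp

locale interval_measure = prob_space \<rho> for \<rho> :: "real measure" +
  fixes c :: real
  assumes c_pos: "c > 0" and sets_\<rho> [measurable_cong]: "sets \<rho> = sets borel"
    and supp: "emeasure \<rho> {0..c} = 1"
begin

abbreviation "S \<equiv> stieltjes \<rho>"

lemma AE_interval: "AE x in \<rho>. x \<in> {0..c}"
  using supp by (intro AE_prob_1) (simp add: measure_def)

lemma integral_interval_mono:
  fixes u v :: "real \<Rightarrow> real"
  assumes "integrable \<rho> u" "integrable \<rho> v" "\<And>x. x \<in> {0..c} \<Longrightarrow> u x \<le> v x"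
  shows "(\<integral>x. u x \<partial>\<rho>) \<le> (\<integral>x. v x \<partial>\<rho>)"
proof (rule integral_mono_AE [OF assms(1,2)])
  show "AE x in \<rho>. u x \<le> v x" using AE_interval by eventually_elim (rule assms(3))
qed

lemma integrable_resolvent:
  assumes "z \<notin> {0..c}"
  shows "integrable \<rho> (\<lambda>x. 1 / (z - x))"
proof -
  define d where "d = (if z < 0 then - z else z - c)"
  have d: "d > 0" "\<And>x. x \<in> {0..c} \<Longrightarrow> d \<le> \<bar>z - x\<bar>"
    using assms c_pos by (auto simp: d_def)
  show ?thesis
  proof (rule integrable_const_bound [where B = "1 / d"])
    show "AE x in \<rho>. norm (1 / (z - x)) \<le> 1 / d"
      using AE_interval
    proof eventually_elim
      case (elim x)
      then show ?case using d by (simp add: abs_divide frac_le)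
    qed
  qed measurable
qed

lemma stieltjes_bounds_right:
  assumes "z > c"
  shows "1 / z \<le> S z" "S z \<le> 1 / (z - c)"
proof -
  have int: "integrable \<rho> (\<lambda>x. 1 / (z - x))" using assms by (intro integrable_resolvent) auto
  have "(\<integral>x. 1 / z \<partial>\<rho>) \<le> S z" unfolding stieltjes_def
    using int assms by (intro integral_interval_mono) (auto intro!: frac_le)
  then show "1 / z \<le> S z" using prob_space by simp
  have "S z \<le> (\<integral>x. 1 / (z - c) \<partial>\<rho>)" unfolding stieltjes_def
    using int assms by (intro integral_interval_mono) (auto intro!: frac_le)
  then show "S z \<le> 1 / (z - c)" using prob_space by simp
qed

lemma stieltjes_bounds_left:
  assumes "z < 0"
  shows "1 / z \<le> S z" "S z \<le> 1 / (z - c)"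
proof -
  have int: "integrable \<rho> (\<lambda>x. 1 / (z - x))" using assms by (intro integrable_resolvent) auto
  have "(\<integral>x. 1 / z \<partial>\<rho>) \<le> S z" unfolding stieltjes_def
    using int assms by (intro integral_interval_mono) (auto simp: divide_simps)
  then show "1 / z \<le> S z" using prob_space by simp
  have "S z \<le> (\<integral>x. 1 / (z - c) \<partial>\<rho>)" unfolding stieltjes_def
    using int assms c_pos by (intro integral_interval_mono) (auto simp: divide_simps)
  then show "S z \<le> 1 / (z - c)" using prob_space by simp
qed

text \<open>The resolvent identity, integrated. It yields both strict monotonicity and continuity of
  \<open>S\<close>.\<close>

lemma stieltjes_diff:
  assumes "z \<notin> {0..c}" "w \<notin> {0..c}"
  shows "S z - S w = (\<integral>x. (w - z) / ((z - x) * (w - x)) \<partial>\<rho>)"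
    and "integrable \<rho> (\<lambda>x. (w - z) / ((z - x) * (w - x)))"
proof -
  note int = integrable_resolvent [OF assms(1)] integrable_resolvent [OF assms(2)]
  \<comment> \<open>Almost everywhere only: at x = z or x = w, outside \<open>{0..c}\<close>,
    division by zero can break the identity.\<close>
  have eq: "AE x in \<rho>. 1 / (z - x) - 1 / (w - x) = (w - z) / ((z - x) * (w - x))"
    using AE_interval
  proof eventually_elim
    case (elim x)
    then have "z - x \<noteq> 0" "w - x \<noteq> 0" using assms by auto
    then show ?case by (simp add: divide_simps)
  qed
  have "S z - S w = (\<integral>x. 1 / (z - x) - 1 / (w - x) \<partial>\<rho>)"
    unfolding stieltjes_def using int by (simp add: Bochner_Integration.integral_diff)
  also have "\<dots> = (\<integral>x. (w - z) / ((z - x) * (w - x)) \<partial>\<rho>)"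
    by (intro integral_cong_AE eq) measurable
  finally show "S z - S w = (\<integral>x. (w - z) / ((z - x) * (w - x)) \<partial>\<rho>)" .
  show "integrable \<rho> (\<lambda>x. (w - z) / ((z - x) * (w - x)))"
    using Bochner_Integration.integrable_diff [OF int] eq by (subst (asm) integrable_cong_AE) auto
qed

text \<open>On one side of the interval (z - x)(w - x) is positive and at most \<open>M\<close>. The
  integrand is thus bounded below by the positive constant (w - z)/M, which gives strictness after
  integration.\<close>

lemma stieltjes_strict_antimono:
  assumes "z < w" "w < 0 \<or> c < z"
  shows "S w < S z"
proof -
  have out: "z \<notin> {0..c}" "w \<notin> {0..c}" using assms by auto
  define M where "M = (\<bar>z\<bar> + c) * (\<bar>w\<bar> + c)"
  have M: "M > 0" unfolding M_def using c_pos by (intro mult_pos_pos) auto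
  have "(\<integral>x. (w - z) / M \<partial>\<rho>) \<le> (\<integral>x. (w - z) / ((z - x) * (w - x)) \<partial>\<rho>)"
  proof (rule integral_interval_mono [OF _ stieltjes_diff(2) [OF out]])
    fix x assume x: "x \<in> {0..c}"
    have pos: "(z - x) * (w - x) > 0"
      using x assms by (auto intro: mult_pos_pos mult_neg_neg)
    have "(z - x) * (w - x) = \<bar>z - x\<bar> * \<bar>w - x\<bar>" using pos by (simp flip: abs_mult)
    also have "\<dots> \<le> M" unfolding M_def using x c_pos by (intro mult_mono) auto
    finally show "(w - z) / M \<le> (w - z) / ((z - x) * (w - x))"
      using assms pos by (intro divide_left_mono) (auto intro: M mult_pos_pos)
  qed simp
  then have "(w - z) / M \<le> S z - S w"
    using stieltjes_diff(1) [OF out] prob_space by simp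
  moreover have "(w - z) / M > 0" using M assms by simp
  ultimately show ?thesis by linarith
qed

text \<open>\<open>S\<close> is strictly monotone on each side of the interval, positive to the
  right and negative to the left, so no value is shared between the sides.\<close>

lemma stieltjes_inj: "inj_on S (- {0..c})"
proof -
  have pos: "S z > 0" if "z > c" for z
    using stieltjes_bounds_right(1) [OF that] that c_pos by (smt (verit) divide_pos_pos)
  have neg: "S z < 0" if "z < 0" for z
    using stieltjes_bounds_left(2) [OF that] that c_pos by (smt (verit) divide_pos_neg)
  have "S z \<noteq> S w" if "z < w" "z \<notin> {0..c}" "w \<notin> {0..c}" for z w
  proof (cases "w < 0 \<or> c < z")
    case True
    then show ?thesis using stieltjes_strict_antimono [OF that(1)] by auto
  next
    case False
    then show ?thesis using pos [of w] neg [of z] that by auto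
  qed
  then show ?thesis unfolding inj_on_def by (metis ComplD linorder_neqE_linordered_idom)
qed

lemma stieltjes_continuous:
  assumes d: "d > 0" and far: "\<And>z x. z \<in> U \<Longrightarrow> x \<in> {0..c} \<Longrightarrow> d \<le> \<bar>z - x\<bar>"
  shows "continuous_on U S"
proof -
  have "(1 / d\<^sup>2)-lipschitz_on U S"
  proof (rule lipschitz_onI)
    fix z w assume zw: "z \<in> U" "w \<in> U"
    have out: "z \<notin> {0..c}" "w \<notin> {0..c}" using far [OF zw(1), of z] far [OF zw(2), of w] d by auto
    have "\<bar>S z - S w\<bar> \<le> (\<integral>x. \<bar>(w - z) / ((z - x) * (w - x))\<bar> \<partial>\<rho>)"
      unfolding stieltjes_diff(1) [OF out] by (rule integral_abs_bound)
    also have "\<dots> \<le> (\<integral>x. \<bar>w - z\<bar> / d\<^sup>2 \<partial>\<rho>)"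
    proof (rule integral_interval_mono)
      fix x assume x: "x \<in> {0..c}"
      have "d * d \<le> \<bar>z - x\<bar> * \<bar>w - x\<bar>"
        using far [OF zw(1) x] far [OF zw(2) x] d by (intro mult_mono) auto
      then show "\<bar>(w - z) / ((z - x) * (w - x))\<bar> \<le> \<bar>w - z\<bar> / d\<^sup>2"
        using d by (simp add: abs_divide abs_mult power2_eq_square frac_le)
    qed (use integrable_abs [OF stieltjes_diff(2) [OF out]] in auto)
    finally show "dist (S z) (S w) \<le> 1 / d\<^sup>2 * dist z w"
      using prob_space by (simp add: dist_real_def abs_minus_commute)
  qed simp
  then show ?thesis by (rule lipschitz_on_continuous_on)
qed

text \<open>An intermediate value argument on each side: the definition of \<open>T_set\<close>
  gives a point near the interval where \<open>S\<close> is beyond 2\<theta>, and the decay of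
  \<open>S\<close> at infinity gives one where it is not.\<close>

lemma stieltjes_preimage:
  assumes \<theta>: "\<theta> \<in> T_set c \<rho>"
  obtains K where "S K = 2 * \<theta>" "\<theta> > 0 \<Longrightarrow> K > c" "\<theta> < 0 \<Longrightarrow> K < 0" "K \<notin> {0..c}"
proof (cases "\<theta> > 0")
  case True
  have "ereal \<theta> < S_max c \<rho> / 2" using \<theta> by (simp add: T_set_def)
  then have "ereal (2 * \<theta>) < S_max c \<rho>"
    by (cases "S_max c \<rho>") (auto simp: ereal_less_divide_pos)
  also have "S_max c \<rho> = (SUP z\<in>{c<..}. ereal (S z))"
    unfolding S_max_def by (intro Lim_at_right_antimono_ereal less_imp_le stieltjes_strict_antimono) auto
  finally obtain z where z: "z > c" "2 * \<theta> < S z" by (auto simp: less_SUP_iff)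
  \<comment> \<open>Far enough to the right that S w \<le> 1/(w - c) \<le> 2\<theta>.\<close>
  define w where "w = max z (c + 1 / (2 * \<theta>))"
  have "1 / (2 * \<theta>) > 0" using True by simp
  then have w: "w > c" "1 / (2 * \<theta>) \<le> w - c" "z \<le> w" using z(1) unfolding w_def by linarith+
  have "1 / (w - c) \<le> 2 * \<theta>" using w True by (simp add: field_simps)
  then have Sw: "S w \<le> 2 * \<theta>" using stieltjes_bounds_right(2) [OF w(1)] by linarith
  have "continuous_on {z..w} S"
    using z(1) by (intro stieltjes_continuous [of "z - c"]) auto
  then obtain K where "z \<le> K" "K \<le> w" "S K = 2 * \<theta>"
    using IVT2' [of S w "2 * \<theta>" z] Sw z w by auto
  then show ?thesis using z True c_pos by (intro that [of K]) auto
next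
  case False
  then have neg: "\<theta> < 0" using \<theta> by (auto simp: T_set_def)
  have "S_min \<rho> / 2 < ereal \<theta>" using \<theta> by (simp add: T_set_def)
  then have "S_min \<rho> < ereal (2 * \<theta>)"
    by (cases "S_min \<rho>") (auto simp: ereal_divide_less_pos)
  also have "S_min \<rho> = (INF z\<in>{..<0}. ereal (S z))"
    unfolding S_min_def by (intro Lim_at_left_antimono_ereal less_imp_le stieltjes_strict_antimono) auto
  finally obtain z where z: "z < 0" "S z < 2 * \<theta>" by (auto simp: INF_less_iff)
  \<comment> \<open>Far enough to the left that S w \<ge> 1/w \<ge> 2\<theta>; both numbers are
    negative.\<close>
  define w where "w = min z (1 / (2 * \<theta>))"
  have w: "w < 0" "w \<le> 1 / (2 * \<theta>)" "w \<le> z" using z(1) unfolding w_def by auto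
  have "2 * \<theta> \<le> 1 / w" using w neg by (simp add: field_simps)
  then have Sw: "2 * \<theta> \<le> S w" using stieltjes_bounds_left(1) [OF w(1)] by linarith
  have "continuous_on {w..z} S"
    using z(1) by (intro stieltjes_continuous [of "- z"]) auto
  then obtain K where "w \<le> K" "K \<le> z" "S K = 2 * \<theta>"
    using IVT2' [of S z "2 * \<theta>" w] Sw z w by auto
  then show ?thesis using z neg by (intro that [of K]) auto
qed

text \<open>The term -1/(2\<theta>) of the R-transform cancels the 1 in the definition of the
  variance.\<close>

lemma limit_variance_eq:
  assumes "S K = 2 * \<theta>" "K \<notin> {0..c}" "\<theta> \<noteq> 0"
  shows "limit_variance c \<rho> \<theta> x = 1 / (2 * \<theta> * (K - x))"
proof -
  have "K_transform c \<rho> (2 * \<theta>) = K"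
    unfolding K_transform_def using assms by (intro the_inv_into_f_eq stieltjes_inj) auto
  then have "1 + 2 * \<theta> * (v_param c \<rho> \<theta> - x) = 2 * \<theta> * (K - x)"
    using assms by (simp add: v_param_def R_transform_def field_simps)
  then show ?thesis by (simp add: limit_variance_def)
qed

end

subsection \<open>Convergence of the Gibbs means\<close>

text \<open>Rationalising puts (sqrt x sqrt y)(sqrt x + sqrt y) in the denominator, which is at
  least l sqrt l. The sharp constant is half of this one.\<close>

lemma inverse_sqrt_lipschitz:
  fixes x y l :: real
  assumes l: "l > 0" "l \<le> x" "l \<le> y"
  shows "\<bar>1 / sqrt x - 1 / sqrt y\<bar> \<le> \<bar>x - y\<bar> / (l * sqrt l)"
proof -
  have sl: "sqrt l > 0" "sqrt l \<le> sqrt x" "sqrt l \<le> sqrt y" using l by auto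
  have x: "x = sqrt x * sqrt x" "y = sqrt y * sqrt y" using l by auto
  have pos: "sqrt x > 0" "sqrt y > 0" using sl by linarith+
  have "x - y = (sqrt x - sqrt y) * (sqrt x + sqrt y)"
    using l by (simp add: algebra_simps)
  then have "\<bar>x - y\<bar> = \<bar>sqrt x - sqrt y\<bar> * (sqrt x + sqrt y)"
    using pos by (simp add: abs_mult)
  then have "\<bar>1 / sqrt x - 1 / sqrt y\<bar> = \<bar>x - y\<bar> / ((sqrt x * sqrt y) * (sqrt x + sqrt y))"
  proof -
    have "1 / sqrt x - 1 / sqrt y = (sqrt y - sqrt x) / (sqrt x * sqrt y)"
      using pos by (simp add: divide_simps)
    then have "\<bar>1 / sqrt x - 1 / sqrt y\<bar> = \<bar>sqrt x - sqrt y\<bar> / (sqrt x * sqrt y)"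
      using pos by (simp add: abs_divide abs_mult abs_minus_commute)
    moreover have "sqrt x + sqrt y \<noteq> 0" using pos by linarith
    ultimately show ?thesis
      unfolding \<open>\<bar>x - y\<bar> = _\<close> by simp
  qed
  also have "\<dots> \<le> \<bar>x - y\<bar> / ((sqrt l * sqrt l) * sqrt l)"
  proof (rule divide_left_mono)
    have *: "sqrt l \<le> sqrt x + sqrt y" using sl pos by linarith
    show "(sqrt l * sqrt l) * sqrt l \<le> (sqrt x * sqrt y) * (sqrt x + sqrt y)"
      using sl pos by (intro mult_mono *) auto
    show "0 < (sqrt x * sqrt y) * (sqrt x + sqrt y) * ((sqrt l * sqrt l) * sqrt l)"
      using sl(1) pos by (intro mult_pos_pos add_pos_pos)
  qed simp
  finally show ?thesis using l by simp
qed

theorem mainTheorem3: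
  fixes c :: real
    and \<gamma> :: "nat \<Rightarrow> nat \<Rightarrow> real"
    and \<rho> :: "real measure"
    and \<theta> :: real
    and f :: "real \<Rightarrow> real"
  assumes "c > 0"
    and "\<And>N i. N \<ge> 1 \<Longrightarrow> i \<in> {1..N} \<Longrightarrow> \<gamma> N i \<in> {0..c}"
    and "prob_space \<rho>" and "sets \<rho> = sets borel" and "emeasure \<rho> {0..c} = 1"
    and "(\<lambda>N. wasserstein1 (empirical_measure N (\<gamma> N)) \<rho>) \<longlonglongrightarrow> 0"
    and "\<theta> \<in> T_set c \<rho>"
    and "1-lipschitz_on UNIV f"
  shows "(\<lambda>N. \<bar>gibbs_mean N (\<gamma> N) \<theta> (\<lambda>g. 1 / real N * (\<Sum>i\<in>{1..N}. f (g i)))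
            - (LINT x:{0..c}|\<rho>. (\<integral>y. f y \<partial>limit_marginal c \<rho> \<theta> x))\<bar>) \<longlonglongrightarrow> 0"
proof -
  note c = assms(1) and \<gamma> = assms(2) and \<theta> = assms(7) and f = assms(8)
  interpret \<rho>: prob_space \<rho> by fact
  interpret interval_measure \<rho> c by standard (use assms in auto)
  note [measurable] = lipschitz_1_borel_measurable [OF f]
  have \<theta>0: "\<theta> \<noteq> 0" using \<theta> by (auto simp: T_set_def)
  obtain K where K: "S K = 2 * \<theta>" "\<theta> > 0 \<Longrightarrow> K > c" "\<theta> < 0 \<Longrightarrow> K < 0" "K \<notin> {0..c}"
    using stieltjes_preimage [OF \<theta>] by blast
  \<comment> \<open>The minimum of 2\<theta>(K - x) over \<open>{0..c}\<close>, attained at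
    \<open>c\<close> or at 0 according to the sign of \<theta>. Its positivity bounds all the
    standard deviations by \<open>b\<close>.\<close>
  define l where "l = (if \<theta> > 0 then 2 * \<theta> * (K - c) else 2 * \<theta> * K)"
  have l: "l > 0"
    using K \<theta>0 by (auto simp: l_def mult_neg_neg)
  have l_le: "l \<le> 2 * \<theta> * (K - x)" if x: "x \<in> {0..c}" for x
  proof (cases "\<theta> > 0")
    case True
    then show ?thesis using x by (simp add: l_def)
  next
    case False
    then have "2 * \<theta> * K \<le> 2 * \<theta> * (K - x)"
      using x by (intro mult_left_mono_neg) auto
    then show ?thesis using False by (simp add: l_def)
  qed
  define b where "b = 1 / sqrt l"
  have b: "b > 0" using l by (simp add: b_def)
  define \<sigma> where "\<sigma> x = 1 / sqrt (2 * \<theta> * (K - x))" for x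
  have \<sigma>: "\<sigma> x > 0" "\<sigma> x \<le> b" "(\<sigma> x)\<^sup>2 = 1 / (2 * \<theta> * (K - x))" if "x \<in> {0..c}" for x
    using l_le [OF that] l by (auto simp: \<sigma>_def b_def power_divide frac_le)
  define L where "L = 2 * \<bar>\<theta>\<bar> / (l * sqrt l)"
  have L: "L \<ge> 0" using l by (simp add: L_def)
  have \<sigma>_lip: "\<bar>\<sigma> x - \<sigma> y\<bar> \<le> L * \<bar>x - y\<bar>" if "x \<in> {0..c}" "y \<in> {0..c}" for x y
  proof -
    have "\<bar>\<sigma> x - \<sigma> y\<bar> \<le> \<bar>2 * \<theta> * (K - x) - 2 * \<theta> * (K - y)\<bar> / (l * sqrt l)"
      unfolding \<sigma>_def by (intro inverse_sqrt_lipschitz l l_le that)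
    also have "2 * \<theta> * (K - x) - 2 * \<theta> * (K - y) = 2 * \<theta> * (y - x)" by (simp add: algebra_simps)
    finally show ?thesis by (simp add: L_def abs_mult abs_minus_commute)
  qed
  \<comment> \<open>On \<open>{0..c}\<close>, \<open>u x\<close> is the mean of \<open>f\<close>
    under \<open>limit_marginal c \<rho> \<theta> x\<close>. Hence \<open>m N\<close> is the mean of
    F under Q for N \<ge> 1, and \<open>ml\<close> is its limit.\<close>
  define u where "u x = (\<integral>y. f (\<sigma> x * y) \<partial>std_normal)" for x
  define ml where "ml = (LINT x:{0..c}|\<rho>. (\<integral>y. f y \<partial>limit_marginal c \<rho> \<theta> x))"
  define m where "m N = 1 / real N * (\<Sum>i\<in>{1..N}. u (\<gamma> N i))" for N
  have ml_eq: "ml = (LINT x:{0..c}|\<rho>. u x)"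
  proof -
    have "(\<integral>y. f y \<partial>limit_marginal c \<rho> \<theta> x) = u x" if x: "x \<in> {0..c}" for x
    proof -
      have "sqrt (limit_variance c \<rho> \<theta> x) = \<sigma> x"
        using limit_variance_eq [OF K(1) K(4) \<theta>0] by (simp add: \<sigma>_def real_sqrt_divide)
      then have "limit_marginal c \<rho> \<theta> x = distr std_normal borel (\<lambda>y. \<sigma> x * y)"
        using distr_std_normal_scale \<sigma>(1) [OF x] by (simp add: limit_marginal_def)
      then show ?thesis by (simp add: u_def integral_distr)
    qed
    then show ?thesis
      unfolding ml_def set_lebesgue_integral_def
      by (intro Bochner_Integration.integral_cong refl) (simp add: indicator_def)
  qed
  have m_lim: "m \<longlonglongrightarrow> ml"
    unfolding m_def ml_eq
  proof (rule wasserstein1_tendsto_mean [OF less_imp_le [OF c] _ \<gamma> assms(3-6)])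
    show "L-lipschitz_on {0..c} u"
    proof (rule lipschitz_onI)
      fix x y assume xy: "x \<in> {0..c}" "y \<in> {0..c}"
      have "\<bar>u x - u y\<bar> \<le> \<bar>\<sigma> x - \<sigma> y\<bar>" unfolding u_def by (rule std_normal_mean_lipschitz [OF f])
      also have "\<dots> \<le> L * \<bar>x - y\<bar>" by (rule \<sigma>_lip [OF xy])
      finally show "dist (u x) (u y) \<le> L * dist x y" by (simp add: dist_real_def)
    qed (rule L)
  qed
  have var_lim: "(\<lambda>N. 1 / real N * (\<Sum>i\<in>{1..N}. (\<sigma> (\<gamma> N i))\<^sup>2)) \<longlonglongrightarrow> 1"
  proof -
    have "(\<lambda>N. 1 / real N * (\<Sum>i\<in>{1..N}. (\<sigma> (\<gamma> N i))\<^sup>2)) \<longlonglongrightarrow> (LINT x:{0..c}|\<rho>. (\<sigma> x)\<^sup>2)"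
    proof (rule wasserstein1_tendsto_mean [OF less_imp_le [OF c] _ \<gamma> assms(3-6)])
      show "(2 * b * L)-lipschitz_on {0..c} (\<lambda>x. (\<sigma> x)\<^sup>2)"
      proof (rule lipschitz_onI)
        fix x y assume xy: "x \<in> {0..c}" "y \<in> {0..c}"
        have "\<bar>(\<sigma> x)\<^sup>2 - (\<sigma> y)\<^sup>2\<bar> = (\<sigma> x + \<sigma> y) * \<bar>\<sigma> x - \<sigma> y\<bar>"
          using \<sigma>(1) [OF xy(1)] \<sigma>(1) [OF xy(2)]
          by (simp add: power2_eq_square square_diff_square_factored abs_mult)
        also have "\<dots> \<le> (2 * b) * (L * \<bar>x - y\<bar>)"
          using \<sigma>(2) [OF xy(1)] \<sigma>(2) [OF xy(2)] b by (intro mult_mono \<sigma>_lip xy) auto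
        finally show "dist ((\<sigma> x)\<^sup>2) ((\<sigma> y)\<^sup>2) \<le> 2 * b * L * dist x y"
          by (simp add: dist_real_def mult.assoc)
      qed (use b L in simp)
    qed
    also have "(LINT x:{0..c}|\<rho>. (\<sigma> x)\<^sup>2) = (\<integral>x. (1 / (2 * \<theta>)) * (1 / (K - x)) \<partial>\<rho>)"
      unfolding set_lebesgue_integral_def
    proof (rule integral_cong_AE)
      show "AE x in \<rho>. indicator {0..c} x *\<^sub>R (\<sigma> x)\<^sup>2 = (1 / (2 * \<theta>)) * (1 / (K - x))"
        using AE_interval by eventually_elim (simp add: \<sigma>(3))
    qed (simp_all add: \<sigma>_def)
    also have "\<dots> = (1 / (2 * \<theta>)) * S K"
      unfolding stieltjes_def by (rule integral_mult_right_zero)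
    also have "\<dots> = 1" using K(1) \<theta>0 by simp
    finally show ?thesis .
  qed
  have tilted: "tilted_product N (\<gamma> N) c \<theta> K b (\<lambda>i. \<sigma> (\<gamma> N i))" if "N \<ge> 1" for N
    using that c \<gamma> \<sigma>
    by unfold_locales auto

  have exp_lim: "(\<lambda>N. exp (- (k * real N))) \<longlonglongrightarrow> 0" if "k > 0" for k :: real
  proof -
    have "filterlim (\<lambda>N. k * real N) at_top sequentially"
      by (rule filterlim_tendsto_pos_mult_at_top [OF tendsto_const that filterlim_real_sequentially])
    then have "filterlim (\<lambda>N. - (k * real N)) at_bot sequentially"
      by (simp only: filterlim_uminus_at_top)
    then show ?thesis by (rule filterlim_compose [OF exp_at_bot])
  qed

  have bad: "(\<lambda>N. measure (gibbs_measure N (\<gamma> N) \<theta>) {g \<in> space (gibbs_measure N (\<gamma> N) \<theta>).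
      \<bar>1 / real N * (\<Sum>i\<in>{1..N}. f (g i)) - m N\<bar> \<ge> \<eta>}) \<longlonglongrightarrow> 0" (is "?pr \<longlonglongrightarrow> 0") if \<eta>: "\<eta> > 0" for \<eta>
  proof -
    define \<kappa> where "\<kappa> = min (1/2) (\<eta> / (2 * (4 * (exp b * (exp (b\<^sup>2) * sqrt 2))))) * \<eta> / 2"
    define A where "A = \<bar>\<theta>\<bar> * c + \<bar>\<theta> * K - 1/2\<bar>"
    \<comment> \<open>Chosen so that 2 A \<delta> \<le> \<kappa>/2: the change of measure uses up at
      most half of the decay rate under Q. It is fixed before \<open>N\<close>, as \<kappa> and
      \<open>A\<close> do not depend on \<open>N\<close>.\<close>
    define \<delta> where "\<delta> = \<kappa> / (4 * (A + 1))"
    define \<kappa>1 where "\<kappa>1 = min (1/4) (\<delta> / (2 * 4)) * \<delta> / 2"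
    define \<kappa>2 where "\<kappa>2 = min (1 / (4 * b\<^sup>2)) ((\<delta> / 2) / (2 * (4 * b ^ 4))) * (\<delta> / 2) / 2"
    have A: "A \<ge> 0" using c by (simp add: A_def)
    have \<kappa>: "\<kappa> > 0" using \<eta> by (simp add: \<kappa>_def)
    then have \<delta>: "\<delta> > 0" using A by (simp add: \<delta>_def)
    have \<kappa>1: "\<kappa>1 > 0" and \<kappa>2: "\<kappa>2 > 0" using \<delta> b by (simp_all add: \<kappa>1_def \<kappa>2_def)
    have A\<delta>: "2 * A * \<delta> \<le> \<kappa> / 2"
      using A \<kappa> by (simp add: \<delta>_def field_simps)
    have "eventually (\<lambda>N. dist (1 / real N * (\<Sum>i\<in>{1..N}. (\<sigma> (\<gamma> N i))\<^sup>2)) 1 < \<delta> / 2) sequentially"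
      using var_lim \<delta> by (intro tendstoD) auto
    \<comment> \<open>The threshold 1/4 makes the bound 2 exp(-\<kappa>2 N) at most 1/2, which
      leaves Q(shell) \<ge> 1/2.\<close>
    moreover have "eventually (\<lambda>N. exp (- (\<kappa>2 * real N)) < 1/4) sequentially"
      using order_tendstoD(2) [OF exp_lim [OF \<kappa>2], of "1/4"] by simp
    ultimately have upper: "eventually (\<lambda>N. ?pr N \<le> 2 * exp (- (\<kappa>1 * real N)) + 4 * exp (- (\<kappa> / 2 * real N))) sequentially"
      using eventually_ge_at_top [of 1]
    proof eventually_elim
      case (elim N)
      interpret T: tilted_product N "\<gamma> N" c \<theta> K b "\<lambda>i. \<sigma> (\<gamma> N i)" by (rule tilted) fact
      let ?B = "{g \<in> space T.G. \<bar>1 / real N * (\<Sum>i\<in>{1..N}. f (g i)) - m N\<bar> \<ge> \<eta>}"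
      have B: "?B \<in> sets T.G" by measurable
      define V where "V = (\<Sum>i\<in>{1..N}. (\<sigma> (\<gamma> N i))\<^sup>2)"
      have "1 / real N * V - 1 = (V - real N) / real N"
        using elim(3) by (simp add: diff_divide_distrib)
      then have "\<bar>V - real N\<bar> / real N < \<delta> / 2"
        using elim(1) unfolding V_def [symmetric] by (simp only: dist_real_def abs_divide abs_of_nat)
      then have V: "\<bar>V - real N\<bar> \<le> \<delta> / 2 * real N"
        using elim(3) by (simp add: pos_divide_less_eq)
      define qs where "qs = measure T.Q {g \<in> space T.G. \<bar>T.r2 g - real N\<bar> < \<delta> * real N}"
      have "1 - qs \<le> 2 * exp (- (\<kappa>2 * real N))"
        using T.Q_norm_concentration [OF \<delta> V [unfolded V_def]] unfolding qs_def \<kappa>2_def .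
      then have half: "qs \<ge> 1/2" using elim(2) by linarith
      have "measure T.P ?B \<le> 2 * exp (- (\<kappa>1 * real N)) + 2 * exp (2 * A * \<delta> * real N) * measure T.Q ?B"
        using T.P_bad_event [OF B \<delta> half [unfolded qs_def]] unfolding \<kappa>1_def A_def .
      also have "measure T.Q ?B \<le> 2 * exp (- (\<kappa> * real N))"
        using T.Q_mean_concentration [OF f \<eta>] unfolding \<kappa>_def m_def u_def .
      also have "2 * exp (2 * A * \<delta> * real N) * (2 * exp (- (\<kappa> * real N)))
          = 4 * exp (2 * A * \<delta> * real N - \<kappa> * real N)"
        by (simp add: exp_add [symmetric])
      also have "\<dots> \<le> 4 * exp (- (\<kappa> / 2 * real N))"
        using mult_right_mono [OF A\<delta>, of "real N"] by (simp add: algebra_simps)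
      finally show ?case by simp
    qed
    have "(\<lambda>N. 2 * exp (- (\<kappa>1 * real N)) + 4 * exp (- (\<kappa> / 2 * real N))) \<longlonglongrightarrow> 2 * 0 + 4 * 0"
      using \<kappa> by (intro tendsto_add tendsto_mult tendsto_const exp_lim \<kappa>1) simp
    then have lim: "(\<lambda>N. 2 * exp (- (\<kappa>1 * real N)) + 4 * exp (- (\<kappa> / 2 * real N))) \<longlonglongrightarrow> 0" by simp
    show ?thesis
      by (rule tendsto_sandwich [OF always_eventually upper tendsto_const lim]) simp
  qed

  show ?thesis
    unfolding ml_def [symmetric]
  proof (rule tendstoI)
    fix e :: real assume e: "e > 0"
    \<comment> \<open>\<open>M\<close> dominates the moment factor of
      \<open>gibbs_mean_approx\<close> once \<open>m N\<close> is within 1 of \<open>ml\<close>. The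
      error splits into four parts of size at most e/4: the deviation level, \<epsilon> M, the bad
      event (probability below \<epsilon> e, divided by 4\<epsilon>), and |m N - ml|.\<close>
    define M where "M = 2 * (\<bar>ml\<bar> + 1)\<^sup>2 + 4 * (f 0)\<^sup>2 + 32"
    have M: "M > 0" unfolding M_def by (intro add_nonneg_pos) auto
    define \<epsilon> where "\<epsilon> = e / (4 * M)"
    have \<epsilon>: "\<epsilon> > 0" "\<epsilon> * M = e / 4" using e M by (simp_all add: \<epsilon>_def)
    have "eventually (\<lambda>N. dist (m N) ml < min 1 (e / 4)) sequentially"
      using m_lim e by (intro tendstoD) auto
    moreover have "eventually (\<lambda>N. measure (gibbs_measure N (\<gamma> N) \<theta>) {g \<in> space (gibbs_measure N (\<gamma> N) \<theta>).
      \<bar>1 / real N * (\<Sum>i\<in>{1..N}. f (g i)) - m N\<bar> \<ge> e / 4} < \<epsilon> * e) sequentially"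
      using e \<epsilon> by (intro order_tendstoD(2) [OF bad]) auto
    ultimately show "eventually (\<lambda>N. dist \<bar>gibbs_mean N (\<gamma> N) \<theta> (\<lambda>g. 1 / real N * (\<Sum>i\<in>{1..N}. f (g i))) - ml\<bar> 0 < e) sequentially"
      using eventually_ge_at_top [of 1]
    proof eventually_elim
      case (elim N)
      interpret T: tilted_product N "\<gamma> N" c \<theta> K b "\<lambda>i. \<sigma> (\<gamma> N i)" by (rule tilted) fact
      define gm where "gm = gibbs_mean N (\<gamma> N) \<theta> (\<lambda>g. 1 / real N * (\<Sum>i\<in>{1..N}. f (g i)))"
      define p where "p = measure T.P {g \<in> space T.P. \<bar>1 / real N * (\<Sum>i\<in>{1..N}. f (g i)) - m N\<bar> \<ge> e / 4}"
      have "\<bar>gm - m N\<bar> \<le> e / 4 + \<epsilon> * (2 * (m N)\<^sup>2 + 4 * (f 0)\<^sup>2 + 32) + p / (4 * \<epsilon>)"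
        unfolding gm_def p_def using e \<epsilon>(1) by (intro T.gibbs_mean_approx f) auto
      moreover have "\<epsilon> * (2 * (m N)\<^sup>2 + 4 * (f 0)\<^sup>2 + 32) \<le> e / 4"
      proof -
        have "\<bar>m N - ml\<bar> < 1" using elim(1) by (simp add: dist_real_def)
        then have "\<bar>m N\<bar> \<le> \<bar>ml\<bar> + 1" by linarith
        then have "(m N)\<^sup>2 \<le> (\<bar>ml\<bar> + 1)\<^sup>2" by (metis abs_ge_zero power2_abs power_mono)
        then have "\<epsilon> * (2 * (m N)\<^sup>2 + 4 * (f 0)\<^sup>2 + 32) \<le> \<epsilon> * M"
          unfolding M_def using \<epsilon>(1) by (intro mult_left_mono) auto
        then show ?thesis using \<epsilon>(2) by simp
      qed
      moreover have "p / (4 * \<epsilon>) < e / 4"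
        using elim(2) \<epsilon>(1) unfolding p_def [symmetric] by (simp add: field_simps)
      moreover have "\<bar>m N - ml\<bar> < e / 4" using elim(1) by (simp add: dist_real_def)
      ultimately have "\<bar>gm - ml\<bar> < e" by linarith
      then show ?case unfolding gm_def by (simp only: dist_real_def abs_idempotent diff_zero)
    qed
  qed
qed

end
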